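(* Let $(a_n)_{n\in\mathbb{N}}$ and $(b_{n,j})_{n,j\in\mathbb{N}}$ be real numbers with $a_n\ge 0$ for all $n$, $b_{n,j}\ge 0$ for all $n,j$, and $b_{n,j}=0$ whenever $n\ge j$. Let $w$ be a weight such that $w_n\ge n$ for all $n\in\mathbb{N}$ and such that there exists $\kappa\in(0,1]$ with $\sum_{n=1}^{j-1}w_nb_{n,j}\le\kappa w_j$ for all $j=2,3,\ldots$. Let $\mathring{u}\in\mathcal{D}(G^{(w)})$, where $G^{(w)}=\overline{A^{(w)}+B^{(w)}}$. Then the abstract Cauchy problem $$u'(t)=G^{(w)}u(t),\quad t>0;\qquad u(0)=\mathring{u},$$ has a unique classical solution, given by $u(t)=S^{(w)}(t)\mathring{u}$. This solution is non-negative if $\mathring{u}\in\mathcal{D}(G^{(w)})_+$. Moreover, if $a_1=0$ and $\sum_{n=1}^{j-1}nb_{n,j}=j$ for all $j=2,3,\ldots$, and $\mathring{u}\in\mathcal{D}(G^{(w)})_+$, then this solution is mass conserving.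
   Context: $\mathbb{N}=\{1,2,\ldots\}$. A weight is a sequence $w=(w_n)_{n=1}^\infty$ of strictly positive reals, and $\ell_w^1$ is the Banach space of real sequences $f=(f_n)_{n=1}^\infty$ with $\|f\|_w=\sum_{n=1}^\infty w_n|f_n|<\infty$, ordered componentwise. For a subspace $D$, $D_+$ denotes the set of its non-negative elements. Operators: $A^{(w)}f=(-a_nf_n)_{n=1}^\infty$ with $\mathcal{D}(A^{(w)})=\{f\in\ell_w^1:(a_nf_n)_n\in\ell_w^1\}$; $B^{(w)}f=\bigl(\sum_{j=n+1}^\infty a_jb_{n,j}f_j\bigr)_{n=1}^\infty$ with $\mathcal{D}(B^{(w)})$ the set of $f\in\ell_w^1$ for which this sequence is well defined and lies in $\ell_w^1$; the sum has domain $\mathcal{D}(A^{(w)})\cap\mathcal{D}(B^{(w)})$ and the overline denotes closure. Under the stated hypotheses on $a_n,b_{n,j},w$, $G^{(w)}$ generates a substochastic $C_0$-semigroup on $\ell_w^1$ (positive, and contractive on the positive cone), denoted $(S^{(w)}(t))_{t\ge0}$. A classical solution is a function $u\in C^1((0,\infty),\ell_w^1)\cap C([0,\infty),\ell_w^1)$ with $u(t)\in\mathcal{D}(G^{(w)})$ for all $t>0$ that satisfies the equation and the initial condition. It is non-negative if $u(t)\ge0$ for all $t\ge0$, and mass conserving if $M_1(u(t))=M_1(\mathring{u})$ for all $t\ge0$, where $M_1(f)=\sum_{n=1}^\infty nf_n$. *)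

theory Defs
  imports "HOL-Analysis.Analysis"
begin

text \<open>
  A sequence \<open>(f\<^sub>n)\<close> with \<open>n = 1, 2, \<dots>\<close> is a function on \<^typ>\<open>nat\<close>. Elements of the
  sequence space are normalised by \<open>f 0 = 0\<close>, so that equality of functions is equality of
  sequences and the index 0 never contributes to a series; the values of weights and coefficients
  at index 0 are irrelevant. Since the space depends on the weight \<open>w\<close>, it is a carrier set with
  an explicit norm and topology, not a type.
\<close>

definition l1w :: "(nat \<Rightarrow> real) \<Rightarrow> (nat \<Rightarrow> real) set" where
  "l1w w = {f. f 0 = 0 \<and> summable (\<lambda>n. w n * \<bar>f n\<bar>)}"

definition norm_w :: "(nat \<Rightarrow> real) \<Rightarrow> (nat \<Rightarrow> real) \<Rightarrow> real" where
  "norm_w w f = (\<Sum>n. w n * \<bar>f n\<bar>)"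

text \<open>
  The value 0 off \<^term>\<open>l1w w\<close> is only there because \<^locale>\<open>Metric_space\<close> demands
  nonnegativity and symmetry on the whole type.
\<close>

definition dist_w :: "(nat \<Rightarrow> real) \<Rightarrow> (nat \<Rightarrow> real) \<Rightarrow> (nat \<Rightarrow> real) \<Rightarrow> real" where
  "dist_w w f g = (if f \<in> l1w w \<and> g \<in> l1w w then norm_w w (\<lambda>n. f n - g n) else 0)"

definition top_w :: "(nat \<Rightarrow> real) \<Rightarrow> (nat \<Rightarrow> real) topology" where
  "top_w w = Metric_space.mtopology (l1w w) (dist_w w)"

definition nonneg :: "(nat \<Rightarrow> real) \<Rightarrow> bool" where
  "nonneg f \<longleftrightarrow> (\<forall>n. 0 \<le> f n)"

definition mass :: "(nat \<Rightarrow> real) \<Rightarrow> real" where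
  "mass f = (\<Sum>n. real n * f n)"

lemma l1w_diff:
  assumes w: "\<forall>n\<ge>1. 0 < w n" and f: "f \<in> l1w w" and g: "g \<in> l1w w"
  shows "(\<lambda>n. f n - g n) \<in> l1w w"
proof -
  have s: "summable (\<lambda>n. w n * \<bar>f n\<bar> + w n * \<bar>g n\<bar>)"
    using f g by (simp add: l1w_def summable_add)
  have le: "norm (w n * \<bar>f n - g n\<bar>) \<le> w n * \<bar>f n\<bar> + w n * \<bar>g n\<bar>" for n
  proof (cases "n = 0")
    case False
    then have "0 < w n" using w by simp
    then have "w n * \<bar>f n - g n\<bar> \<le> w n * (\<bar>f n\<bar> + \<bar>g n\<bar>)"
      by (intro mult_left_mono) auto
    with \<open>0 < w n\<close> show ?thesis by (simp add: abs_mult distrib_left)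
  qed (use f g in \<open>simp add: l1w_def\<close>)
  have "summable (\<lambda>n. w n * \<bar>f n - g n\<bar>)"
    by (rule summable_comparison_test'[OF s, of 0]) (rule le)
  with f g show ?thesis by (simp add: l1w_def)
qed

lemma Metric_space_l1w:
  assumes w: "\<forall>n\<ge>1. 0 < w n"
  shows "Metric_space (l1w w) (dist_w w)"
proof
  have nn: "0 \<le> w n * \<bar>f n\<bar>" if "f \<in> l1w w" for f n
    using that spec[OF w, of n] by (cases "n = 0") (auto simp: l1w_def)
  show "0 \<le> dist_w w f g" for f g
  proof (cases "f \<in> l1w w \<and> g \<in> l1w w")
    case True
    then have *: "(\<lambda>n. f n - g n) \<in> l1w w" using l1w_diff[OF w] by blast
    then have "summable (\<lambda>n. w n * \<bar>f n - g n\<bar>)" by (simp add: l1w_def)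
    then show ?thesis using True nn[OF *] by (simp add: dist_w_def norm_w_def suminf_nonneg)
  qed (auto simp: dist_w_def)
  show "dist_w w f g = dist_w w g f" for f g
  proof -
    have "norm_w w (\<lambda>n. f n - g n) = norm_w w (\<lambda>n. g n - f n)"
      unfolding norm_w_def by (subst abs_minus_commute) (rule refl)
    then show ?thesis by (auto simp: dist_w_def)
  qed
  show "dist_w w f g = 0 \<longleftrightarrow> f = g" if f: "f \<in> l1w w" and g: "g \<in> l1w w" for f g
  proof
    assume d: "dist_w w f g = 0"
    have *: "(\<lambda>n. f n - g n) \<in> l1w w" using l1w_diff[OF w f g] .
    then have s: "summable (\<lambda>n. w n * \<bar>f n - g n\<bar>)" by (simp add: l1w_def)
    have "(\<Sum>n. w n * \<bar>f n - g n\<bar>) = 0" using d f g by (simp add: dist_w_def norm_w_def)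
    then have z: "\<forall>n. w n * \<bar>f n - g n\<bar> = 0"
      using suminf_eq_zero_iff[OF s nn[OF *]] by blast
    have "f n = g n" for n
    proof (cases "n = 0")
      case False
      then have "0 < w n" using w by simp
      then show ?thesis using z[rule_format, of n] by simp
    qed (use f g in \<open>simp add: l1w_def\<close>)
    then show "f = g" by blast
  qed (use f in \<open>simp add: dist_w_def norm_w_def\<close>)
  show "dist_w w f h \<le> dist_w w f g + dist_w w g h"
    if f: "f \<in> l1w w" and g: "g \<in> l1w w" and h: "h \<in> l1w w" for f g h
  proof -
    have s: "summable (\<lambda>n. w n * \<bar>f n - g n\<bar>)" "summable (\<lambda>n. w n * \<bar>g n - h n\<bar>)"
      "summable (\<lambda>n. w n * \<bar>f n - h n\<bar>)"
      using l1w_diff[OF w] f g h by (auto simp: l1w_def)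
    have "w n * \<bar>f n - h n\<bar> \<le> w n * \<bar>f n - g n\<bar> + w n * \<bar>g n - h n\<bar>" for n
    proof (cases "n = 0")
      case False
      then have "0 < w n" using w by simp
      then have "w n * \<bar>f n - h n\<bar> \<le> w n * (\<bar>f n - g n\<bar> + \<bar>g n - h n\<bar>)"
        by (intro mult_left_mono) auto
      then show ?thesis by (simp add: distrib_left)
    qed (use f g h in \<open>simp add: l1w_def\<close>)
    then show ?thesis
      using f g h s suminf_le[OF _ s(3) summable_add[OF s(1,2)]] suminf_add[OF s(1,2)]
      by (simp add: dist_w_def norm_w_def)
  qed
qed

text \<open>Unbounded operators are represented by their graphs, so that \<^const>\<open>Domain\<close> is their domain.\<close>

type_synonym graph = "((nat \<Rightarrow> real) \<times> (nat \<Rightarrow> real)) set"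

definition A_op :: "(nat \<Rightarrow> real) \<Rightarrow> (nat \<Rightarrow> real) \<Rightarrow> graph" where
  "A_op w a = {(f, \<lambda>n. - a n * f n) | f. f \<in> l1w w \<and> (\<lambda>n. a n * f n) \<in> l1w w}"

definition B_seq ::
    "(nat \<Rightarrow> real) \<Rightarrow> (nat \<Rightarrow> nat \<Rightarrow> real) \<Rightarrow> (nat \<Rightarrow> real) \<Rightarrow> nat \<Rightarrow> real" where
  "B_seq a b f n =
     (if n = 0 then 0 else (\<Sum>k. a (n + 1 + k) * b n (n + 1 + k) * f (n + 1 + k)))"

definition B_op :: "(nat \<Rightarrow> real) \<Rightarrow> (nat \<Rightarrow> real) \<Rightarrow> (nat \<Rightarrow> nat \<Rightarrow> real) \<Rightarrow> graph" where
  "B_op w a b = {(f, B_seq a b f) | f. f \<in> l1w w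
     \<and> (\<forall>n\<ge>1. summable (\<lambda>k. a (n + 1 + k) * b n (n + 1 + k) * f (n + 1 + k)))
     \<and> B_seq a b f \<in> l1w w}"

definition op_sum :: "graph \<Rightarrow> graph \<Rightarrow> graph" where
  "op_sum P Q = {(f, \<lambda>n. g n + h n) | f g h. (f, g) \<in> P \<and> (f, h) \<in> Q}"

definition op_closure :: "(nat \<Rightarrow> real) \<Rightarrow> graph \<Rightarrow> graph" where
  "op_closure w P = prod_topology (top_w w) (top_w w) closure_of P"

definition G_op :: "(nat \<Rightarrow> real) \<Rightarrow> (nat \<Rightarrow> real) \<Rightarrow> (nat \<Rightarrow> nat \<Rightarrow> real) \<Rightarrow> graph" where
  "G_op w a b = op_closure w (op_sum (A_op w a) (B_op w a b))"

type_synonym op_family = "real \<Rightarrow> (nat \<Rightarrow> real) \<Rightarrow> (nat \<Rightarrow> real)"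

definition bounded_linear_on_l1w ::
    "(nat \<Rightarrow> real) \<Rightarrow> ((nat \<Rightarrow> real) \<Rightarrow> (nat \<Rightarrow> real)) \<Rightarrow> bool" where
  "bounded_linear_on_l1w w T \<longleftrightarrow>
     (\<forall>f\<in>l1w w. T f \<in> l1w w) \<and>
     (\<forall>f\<in>l1w w. \<forall>g\<in>l1w w. \<forall>n. T (\<lambda>m. f m + g m) n = T f n + T g n) \<and>
     (\<forall>f\<in>l1w w. \<forall>c n. T (\<lambda>m. c * f m) n = c * T f n) \<and>
     (\<exists>C. \<forall>f\<in>l1w w. norm_w w (T f) \<le> C * norm_w w f)"

definition C0_semigroup :: "(nat \<Rightarrow> real) \<Rightarrow> op_family \<Rightarrow> bool" where
  "C0_semigroup w S \<longleftrightarrow>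
     (\<forall>t\<ge>0. bounded_linear_on_l1w w (S t)) \<and>
     (\<forall>f\<in>l1w w. S 0 f = f) \<and>
     (\<forall>s\<ge>0. \<forall>t\<ge>0. \<forall>f\<in>l1w w. S (s + t) f = S s (S t f)) \<and>
     (\<forall>f\<in>l1w w. limitin (top_w w) (\<lambda>t. S t f) f (at_right 0))"

definition substochastic :: "(nat \<Rightarrow> real) \<Rightarrow> op_family \<Rightarrow> bool" where
  "substochastic w S \<longleftrightarrow>
     (\<forall>t\<ge>0. \<forall>f\<in>l1w w. nonneg f \<longrightarrow> nonneg (S t f) \<and> norm_w w (S t f) \<le> norm_w w f)"

definition generator :: "(nat \<Rightarrow> real) \<Rightarrow> op_family \<Rightarrow> graph" where
  "generator w S =
     {(f, g). f \<in> l1w w \<and> limitin (top_w w) (\<lambda>h n. (S h f n - f n) / h) g (at_right 0)}"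

text \<open>
  A \<open>C\<^sub>0\<close>-semigroup is determined by its generator only for times \<open>t \<ge> 0\<close> and on the carrier
  \<^term>\<open>l1w w\<close>, hence the indefinite choice; the values elsewhere are immaterial.
\<close>

definition generated_semigroup :: "(nat \<Rightarrow> real) \<Rightarrow> graph \<Rightarrow> op_family" where
  "generated_semigroup w G = (SOME S. C0_semigroup w S \<and> generator w S = G)"

definition has_derivative_w ::
    "(nat \<Rightarrow> real) \<Rightarrow> (real \<Rightarrow> nat \<Rightarrow> real) \<Rightarrow> (nat \<Rightarrow> real) \<Rightarrow> real \<Rightarrow> bool" where
  "has_derivative_w w u v t \<longleftrightarrow> limitin (top_w w) (\<lambda>h n. (u (t + h) n - u t n) / h) v (at 0)"

text \<open>The condition \<open>(u t, u' t) \<in> G\<close> says both \<open>u t \<in> Domain G\<close> and \<open>u' t = G (u t)\<close>.\<close>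

definition classical_solution ::
    "(nat \<Rightarrow> real) \<Rightarrow> graph \<Rightarrow> (nat \<Rightarrow> real) \<Rightarrow> (real \<Rightarrow> nat \<Rightarrow> real) \<Rightarrow> bool" where
  "classical_solution w G u0 u \<longleftrightarrow>
     continuous_map (top_of_set {0..}) (top_w w) u \<and>
     (\<exists>u'. continuous_map (top_of_set {0<..}) (top_w w) u' \<and>
           (\<forall>t>0. has_derivative_w w u (u' t) t \<and> (u t, u' t) \<in> G)) \<and>
     u 0 = u0"

end

theory Submission
  imports Defs
begin

text \<open>
  Since fragmentation only produces smaller pieces, the span of the first \<open>N\<close> unit sequences is
  invariant under \<open>A + B\<close>, and the Cauchy problem restricted to it is a triangular linear system
  with positive solutions. The weight condition makes the weighted norm non-increasing along them,
  so the solution matrix extends to a substochastic semigroup \<open>T\<close> on the whole space. The range of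
  \<open>1 - (A + B)\<close> on finite sequences contains all finite sequences; as the generator of \<open>T\<close> is
  dissipative, it is the closure of \<open>A + B\<close> restricted to finite sequences. Truncation shows that
  this closure is \<open>G\<close>.
\<close>

section \<open>Semigroups of contractions\<close>

text \<open>The semigroup is exhibited rather than obtained from a generation theorem, which leaves
  two gaps. The generator of \<open>T\<close> is known on finite sequences only; dissipativity
  bounds \<open>x\<close> by \<open>x - g\<close>, so density of the range at the single value 1 is
  enough to recognise the whole generator. And \<open>generated_semigroup\<close> is an indefinite
  choice among strongly continuous semigroups, with neither positivity nor a growth bound given, so
  it must be shown to coincide with \<open>T\<close>. The uniqueness argument therefore relies on
  the contractivity of \<open>T\<close> alone and on right derivatives: if \<open>u\<close> follows
  the generator, \<open>u (s + h)\<close> differs from \<open>T h (u s)\<close> by o(h), so the norm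
  of the difference of two solutions has nonpositive upper right Dini derivative. The same argument
  gives uniqueness of classical solutions. Closedness of the generator comes from a mean value
  inequality, which takes the place of the integral representation of orbits.\<close>

text \<open>The gaps to the right of distinct points are disjoint: for \<open>s < t\<close> the
  point \<open>t\<close> is not in the gap of \<open>s\<close>, so that gap ends no later than
  \<open>t\<close>. Disjoint nonempty open sets of reals are countable in number.\<close>

lemma countable_right_isolated:
  fixes D :: "real set"
  assumes "\<And>t. t \<in> D \<Longrightarrow> \<exists>d>0. {t<..<t+d} \<inter> D = {}"
  shows "countable D"
proof -
  obtain d where d: "\<And>t. t \<in> D \<Longrightarrow> d t > 0" "\<And>t. t \<in> D \<Longrightarrow> {t<..<t+d t} \<inter> D = {}"
    using assms by metis
  define I where "I t = {t<..<t + d t}" for t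
  have sep: "I s \<inter> I t = {}" if "s \<in> D" "t \<in> D" "s < t" for s t
  proof -
    have "t \<notin> I s" using d(2)[OF that(1)] that by (auto simp: I_def)
    then show ?thesis using that by (auto simp: I_def)
  qed
  have disj: "I s \<inter> I t = {}" if "s \<in> D" "t \<in> D" "s \<noteq> t" for s t
    using sep[of s t] sep[of t s] that by (cases "s < t") auto
  have ne: "I t \<noteq> {}" if "t \<in> D" for t
    using d(1)[OF that] by (simp add: I_def)
  have "countable (I ` D)"
    by (rule countable_disjoint_open_subsets)
      (auto simp: I_def[abs_def] disjoint_def dest: disj[unfolded I_def])
  moreover have "inj_on I D"
    using disj ne by (force intro: inj_onI)
  ultimately show ?thesis
    by (rule countable_image_inj_on)
qed

text \<open>\<open>D n\<close> collects the points where the left limit fails at precision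
  \<open>1 / Suc n\<close>. Right continuity at \<open>t\<close> keeps all values shortly after
  \<open>t\<close> within half of that of \<open>f t\<close>, hence within \<open>1 / Suc n\<close>
  of each other, so \<open>D n\<close> has no further point there and is right-isolated.\<close>

lemma right_continuous_countable_left_discont:
  fixes f :: "real \<Rightarrow> 'a::metric_space"
  assumes right: "\<And>t. t > 0 \<Longrightarrow> (f \<longlongrightarrow> f t) (at_right t)"
  shows "countable {t. t > 0 \<and> \<not> (f \<longlongrightarrow> f t) (at_left t)}"
proof -
  define D where
    "D n = {t. t > 0 \<and> \<not> (\<forall>\<^sub>F s in at_left t. dist (f s) (f t) < 1 / Suc n)}" for n
  have "countable (D n)" for n
  proof (rule countable_right_isolated)
    fix t assume "t \<in> D n"
    then have t: "t > 0" by (simp add: D_def)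
    have "\<forall>\<^sub>F s in at_right t. dist (f s) (f t) < 1 / (2 * Suc n)"
      using right[OF t] by (rule tendstoD) simp
    then obtain c where c: "c > t" "\<And>s. t < s \<Longrightarrow> s < c \<Longrightarrow> dist (f s) (f t) < 1 / (2 * Suc n)"
      by (auto simp: eventually_at_right_field)
    have "s \<notin> D n" if s: "t < s" "s < c" for s
    proof -
      have "dist (f r) (f s) < 1 / Suc n" if "t < r" "r < s" for r
      proof -
        have "dist (f r) (f s) \<le> dist (f r) (f t) + dist (f s) (f t)"
          by (rule dist_triangle2)
        also have "\<dots> < 1 / (2 * Suc n) + 1 / (2 * Suc n)"
          using that s by (intro add_strict_mono c) auto
        finally show ?thesis by (simp add: field_simps)
      qed
      then have "\<forall>\<^sub>F r in at_left s. dist (f r) (f s) < 1 / Suc n"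
        using s(1) by (auto simp: eventually_at_left_field)
      then show ?thesis by (simp add: D_def)
    qed
    then have "{t<..<t + (c - t)} \<inter> D n = {}" by auto
    then show "\<exists>d>0. {t<..<t+d} \<inter> D n = {}" using c(1) by (metis diff_gt_0_iff_gt)
  qed
  moreover have "{t. t > 0 \<and> \<not> (f \<longlongrightarrow> f t) (at_left t)} \<subseteq> (\<Union>n. D n)"
  proof
    fix t assume t: "t \<in> {t. t > 0 \<and> \<not> (f \<longlongrightarrow> f t) (at_left t)}"
    then obtain e where e: "e > 0" "\<not> (\<forall>\<^sub>F s in at_left t. dist (f s) (f t) < e)"
      by (auto simp: tendsto_iff)
    obtain n where "1 / Suc n < e" using nat_approx_posE[OF e(1)] .
    have "\<not> (\<forall>\<^sub>F s in at_left t. dist (f s) (f t) < 1 / Suc n)"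
    proof
      assume "\<forall>\<^sub>F s in at_left t. dist (f s) (f t) < 1 / Suc n"
      then have "\<forall>\<^sub>F s in at_left t. dist (f s) (f t) < e"
        by (rule eventually_mono) (use \<open>1 / Suc n < e\<close> in linarith)
      with e(2) show False ..
    qed
    then have "t \<in> D n" using t by (simp add: D_def)
    then show "t \<in> (\<Union>n. D n)" by blast
  qed
  ultimately show ?thesis
    using countable_subset[OF _ countable_UN[of UNIV D]] by simp
qed

text \<open>The hypothesis \<open>dini\<close> says that the upper right Dini derivative is at most
  0. It is demanded at interior points only, because solutions satisfy their equation for
  \<open>t > 0\<close> only; the endpoints are reached by continuity.\<close>

lemma right_Dini_nonincreasing:
  fixes \<phi> :: "real \<Rightarrow> real"
  assumes ab: "a \<le> b" and cont: "continuous_on {a..b} \<phi>"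
    and dini: "\<And>t e. a < t \<Longrightarrow> t < b \<Longrightarrow> e > 0 \<Longrightarrow> \<forall>\<^sub>F h in at_right 0. \<phi> (t + h) \<le> \<phi> t + e * h"
  shows "\<phi> b \<le> \<phi> a"
proof -
  have main: "\<phi> d \<le> \<phi> c + e * (d - c)" if c: "a < c" "c < d" "d < b" and e: "e > 0" for c d e
  proof -
    define A where "A = {t \<in> {c..d}. \<phi> t \<le> \<phi> c + e * (t - c)}"
    have "continuous_on {c..d} \<phi>" using cont c by (auto intro: continuous_on_subset)
    then have "closed A"
      unfolding A_def by (intro continuous_on_closed_Collect_le continuous_intros) auto
    moreover have ne: "c \<in> A" using c by (simp add: A_def)
    moreover have bdd: "bdd_above A" by (rule bdd_aboveI[of _ d]) (simp add: A_def)
    ultimately have "Sup A \<in> A" using closed_contains_Sup by blast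
    define s where "s = Sup A"
    have s: "c \<le> s" "s \<le> d" "\<phi> s \<le> \<phi> c + e * (s - c)"
      using \<open>Sup A \<in> A\<close> by (auto simp: A_def s_def)
    \<comment> \<open>If \<open>s < d\<close>, the Dini condition at \<open>s\<close> would put
      points \<open>s + h\<close> into \<open>A\<close> beyond its supremum.\<close>
    have "s = d"
    proof (rule ccontr)
      assume "s \<noteq> d"
      with s have "s < d" by simp
      have "\<forall>\<^sub>F h in at_right 0. \<phi> (s + h) \<le> \<phi> s + e * h"
        using dini[of s e] s c e by simp
      moreover have "\<forall>\<^sub>F h in at_right 0. h < d - s"
        using eventually_at_right_real[of 0 "d - s"] \<open>s < d\<close> by (auto elim!: eventually_mono)
      moreover have "\<forall>\<^sub>F h in at_right (0::real). h > 0"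
        by (simp add: eventually_at_right_less)
      ultimately have "\<forall>\<^sub>F h in at_right 0. s + h \<in> A \<and> h > 0"
      proof eventually_elim
        case (elim h)
        then have "\<phi> (s + h) \<le> \<phi> c + e * (s + h - c)"
          using s by (simp add: algebra_simps)
        then show ?case using elim s by (simp add: A_def)
      qed
      then obtain h where "s + h \<in> A" "h > 0"
        using eventually_happens'[OF trivial_limit_at_right_real] by blast
      then have "s + h \<le> s" unfolding s_def using bdd by (intro cSup_upper)
      with \<open>h > 0\<close> show False by simp
    qed
    with s show ?thesis by simp
  qed
  show ?thesis
  proof (cases "a = b")
    case False
    with ab have "a < b" by simp
    have 1: "\<phi> d \<le> \<phi> c" if "a < c" "c < d" "d < b" for c d
    proof (rule field_le_epsilon)
      fix e :: real assume "e > 0"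
      then show "\<phi> d \<le> \<phi> c + e" using main[OF that, of "e / (d - c)"] that by simp
    qed
    \<comment> \<open>A fixed interior point lets the two endpoints be approached
      separately.\<close>
    define m where "m = (a + b) / 2"
    have m: "a < m" "m < b" using \<open>a < b\<close> by (auto simp: m_def)
    have "(\<phi> \<longlongrightarrow> \<phi> a) (at_right a)"
      using cont \<open>a < b\<close> by (simp add: continuous_on_Icc_at_rightD)
    moreover have "\<forall>\<^sub>F c in at_right a. \<phi> m \<le> \<phi> c"
      using m 1 by (auto simp: eventually_at_right_field)
    ultimately have "\<phi> m \<le> \<phi> a" by (intro tendsto_lowerbound[of \<phi>]) auto
    moreover have "(\<phi> \<longlongrightarrow> \<phi> b) (at_left b)"
      using cont \<open>a < b\<close> by (simp add: continuous_on_Icc_at_leftD)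
    moreover have "\<forall>\<^sub>F c in at_left b. \<phi> c \<le> \<phi> m"
      using m 1 by (auto simp: eventually_at_left_field)
    ultimately have "\<phi> b \<le> \<phi> m" by (intro tendsto_upperbound[of \<phi>]) auto
    with \<open>\<phi> m \<le> \<phi> a\<close> show ?thesis by simp
  qed simp
qed

lemma has_vector_derivative_iff_quotient:
  fixes f :: "real \<Rightarrow> 'a::real_normed_vector"
  shows "(f has_vector_derivative D) (at x) \<longleftrightarrow> ((\<lambda>h. (f (x + h) - f x) /\<^sub>R h) \<longlongrightarrow> D) (at 0)"
proof -
  have "norm (f (x + h) - f x - h *\<^sub>R D) / norm h = norm ((f (x + h) - f x) /\<^sub>R h - D)"
    if "h \<noteq> 0" for h
  proof -
    have "(f (x + h) - f x) /\<^sub>R h - D = (f (x + h) - f x - h *\<^sub>R D) /\<^sub>R h"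
      using that by (simp add: scaleR_diff_right)
    then show ?thesis by (simp add: divide_inverse_commute)
  qed
  then have "((\<lambda>h. norm (f (x + h) - f x - h *\<^sub>R D) / norm h) \<longlongrightarrow> 0) (at 0)
      \<longleftrightarrow> ((\<lambda>h. norm ((f (x + h) - f x) /\<^sub>R h - D)) \<longlongrightarrow> 0) (at 0)"
    by (intro tendsto_cong) (auto simp: eventually_at_filter)
  then show ?thesis
    unfolding has_vector_derivative_def has_derivative_at
    by (simp only: tendsto_norm_zero_iff LIM_zero_iff bounded_linear_scaleR_left simp_thms)
qed

section \<open>Generators, orbits and uniqueness for semigroups on a normed space\<close>

definition sg_generator :: "(real \<Rightarrow> 'a \<Rightarrow> 'a) \<Rightarrow> ('a::real_normed_vector \<times> 'a) set" where
  "sg_generator S = {(x, g). ((\<lambda>h. (S h x - x) /\<^sub>R h) \<longlongrightarrow> g) (at_right 0)}"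

lemma sg_generator_diff:
  assumes "\<And>t. t \<ge> 0 \<Longrightarrow> bounded_linear (S t)"
    and "(x, g) \<in> sg_generator S" "(y, k) \<in> sg_generator S"
  shows "(x - y, g - k) \<in> sg_generator S"
proof -
  have "((\<lambda>h. (S h x - x) /\<^sub>R h - (S h y - y) /\<^sub>R h) \<longlongrightarrow> g - k) (at_right 0)"
    using assms(2,3) by (auto simp: sg_generator_def intro: tendsto_diff)
  moreover have "\<forall>\<^sub>F h in at_right 0. (S h x - x) /\<^sub>R h - (S h y - y) /\<^sub>R h
      = (S h (x - y) - (x - y)) /\<^sub>R h"
    using eventually_at_right_less[of 0]
  proof eventually_elim
    case (elim h)
    then interpret bounded_linear "S h" using assms(1) by simp
    show ?case by (simp add: diff algebra_simps)
  qed
  ultimately show ?thesis by (simp add: sg_generator_def tendsto_cong)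
qed

text \<open>No bound uniform in \<open>t\<close> is assumed: the locale has to fit the semigroup
  picked by \<open>generated_semigroup\<close>, and \<open>C0_semigroup\<close> only says that each
  single operator is bounded.\<close>

locale C0_sg =
  fixes S :: "real \<Rightarrow> 'a \<Rightarrow> 'a::real_normed_vector"
  assumes bl: "t \<ge> 0 \<Longrightarrow> bounded_linear (S t)"
    and zero: "S 0 x = x"
    and add: "s \<ge> 0 \<Longrightarrow> t \<ge> 0 \<Longrightarrow> S (s + t) x = S s (S t x)"
    and cont0: "((\<lambda>t. S t x) \<longlongrightarrow> x) (at_right 0)"
begin

lemma diff: "t \<ge> 0 \<Longrightarrow> S t (x - y) = S t x - S t y"
  using bl linear_diff bounded_linear.linear by blast

lemma right_continuous:
  assumes "t \<ge> 0"
  shows "((\<lambda>t. S t x) \<longlongrightarrow> S t x) (at_right t)"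
proof -
  have "((\<lambda>h. S t (S h x)) \<longlongrightarrow> S t x) (at_right 0)"
    by (rule bounded_linear.tendsto[OF bl[OF assms] cont0])
  moreover have "\<forall>\<^sub>F h in at_right 0. S t (S h x) = S (h + t) x"
    using eventually_at_right_less[of 0]
    by eventually_elim (use assms in \<open>simp add: add flip: add.commute[of t]\<close>)
  ultimately show ?thesis
    by (subst filterlim_at_right_to_0) (simp add: tendsto_cong)
qed

text \<open>
  No bound on the operator norms near 0 is at hand. But if the orbit is left-continuous at \<open>r\<close>, it
  is so at every later time, since \<open>S (t - r)\<close> is continuous; and a right-continuous function has
  only countably many discontinuities.
\<close>

lemma continuous_orbit: "continuous_on {0..} (\<lambda>t. S t x)"
proof -
  have left: "((\<lambda>t. S t x) \<longlongrightarrow> S t x) (at_left t)" if t: "t > 0" for t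
  proof -
    let ?D = "{t. t > 0 \<and> \<not> ((\<lambda>t. S t x) \<longlongrightarrow> S t x) (at_left t)}"
    have "countable ?D"
      by (rule right_continuous_countable_left_discont) (simp add: right_continuous)
    then have "\<not> {0<..<t} \<subseteq> ?D"
      using t countable_subset uncountable_open_interval by blast
    then obtain r where r: "0 < r" "r < t" "((\<lambda>t. S t x) \<longlongrightarrow> S r x) (at_left r)"
      by auto
    have "((\<lambda>s. S (t - r) (S s x)) \<longlongrightarrow> S (t - r) (S r x)) (at_left r)"
      using r by (intro bounded_linear.tendsto[OF bl]) auto
    moreover have "\<forall>\<^sub>F s in at_left r. S (t - r) (S s x) = S (s + (t - r)) x"
    proof -
      have "\<forall>\<^sub>F s in at_left r. s > 0" using r(1) eventually_at_left_real[of 0 r]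
        by (auto elim!: eventually_mono)
      then show ?thesis
        by eventually_elim (use r in \<open>simp add: add flip: add.commute[of "t - r"]\<close>)
    qed
    ultimately have "((\<lambda>s. S (s + (t - r)) x) \<longlongrightarrow> S t x) (at_left r)"
      using add[of "t - r" r x] r by (simp add: tendsto_cong)
    moreover have "at_left t = filtermap (\<lambda>s. s + (t - r)) (at_left r)"
      using filtermap_at_left_shift[of "r - t" r] by (simp add: diff_diff_eq2 add_diff_eq)
    ultimately show ?thesis by (simp add: filterlim_filtermap)
  qed
  show ?thesis
    unfolding continuous_on_def
  proof
    fix t :: real assume "t \<in> {0..}"
    show "((\<lambda>t. S t x) \<longlongrightarrow> S t x) (at t within {0..})"
    proof (cases "t = 0")
      case True
      then show ?thesis using right_continuous[of 0] by (simp add: at_within_Ici_at_right)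
    next
      case False
      then have "t > 0" using \<open>t \<in> {0..}\<close> by simp
      then have "((\<lambda>t. S t x) \<longlongrightarrow> S t x) (at t)"
        using left right_continuous by (intro filterlim_split_at) auto
      then show ?thesis by (rule tendsto_within_subset[of _ _ _ UNIV]) auto
    qed
  qed
qed

text \<open>\<open>S t\<close> commutes with the difference quotient at 0. Its image can be read as
  the quotient of \<open>S h\<close> at the point \<open>S t x\<close> or as the right difference
  quotient of the orbit. A left derivative does not come out this way: there
  \<open>S (t - h)\<close> acts on the remainder, which calls for a bound uniform in
  \<open>h\<close>.\<close>

lemma generator_invariant:
  assumes "(x, g) \<in> sg_generator S" "t \<ge> 0"
  shows "(S t x, S t g) \<in> sg_generator S"
    and "((\<lambda>h. (S (t + h) x - S t x) /\<^sub>R h) \<longlongrightarrow> S t g) (at_right 0)"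
proof -
  interpret T: bounded_linear "S t" using assms bl by blast
  have *: "((\<lambda>h. S t ((S h x - x) /\<^sub>R h)) \<longlongrightarrow> S t g) (at_right 0)"
    using assms by (intro T.tendsto) (simp add: sg_generator_def)
  have "\<forall>\<^sub>F h in at_right 0. S t ((S h x - x) /\<^sub>R h) = (S (t + h) x - S t x) /\<^sub>R h"
    using eventually_at_right_less[of 0]
    by eventually_elim (use assms in \<open>simp add: add T.diff T.scaleR\<close>)
  with * show "((\<lambda>h. (S (t + h) x - S t x) /\<^sub>R h) \<longlongrightarrow> S t g) (at_right 0)"
    by (simp add: tendsto_cong)
  have "\<forall>\<^sub>F h in at_right 0. S t ((S h x - x) /\<^sub>R h) = (S h (S t x) - S t x) /\<^sub>R h"
    using eventually_at_right_less[of 0]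
    by eventually_elim
      (use assms in \<open>simp add: T.diff T.scaleR add[symmetric] add.commute\<close>)
  with * show "(S t x, S t g) \<in> sg_generator S"
    by (simp add: tendsto_cong sg_generator_def)
qed

end

locale contraction_sg = C0_sg +
  assumes contraction: "t \<ge> 0 \<Longrightarrow> norm (S t x) \<le> norm x"
begin

text \<open>This is the dissipativity estimate at the value 1, matching the range condition in
  \<open>core_range\<close>. It already holds for the difference quotients, since \<open>S h\<close>
  does not increase the norm, and passes to the limit.\<close>

lemma dissipative:
  assumes "(x, g) \<in> sg_generator S"
  shows "norm x \<le> norm (x - g)"
proof -
  have "((\<lambda>h. norm (x - (S h x - x) /\<^sub>R h)) \<longlongrightarrow> norm (x - g)) (at_right 0)"
    using assms by (auto simp: sg_generator_def intro!: tendsto_intros)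
  moreover have "\<forall>\<^sub>F h in at_right 0. norm x \<le> norm (x - (S h x - x) /\<^sub>R h)"
    using eventually_at_right_less[of 0]
  proof eventually_elim
    case (elim h)
    have eq: "x - (S h x - x) /\<^sub>R h = (1 + 1 / h) *\<^sub>R x - (1 / h) *\<^sub>R S h x"
      by (simp add: algebra_simps divide_inverse)
    moreover have "norm ((1 + 1 / h) *\<^sub>R x) - norm ((1 / h) *\<^sub>R S h x)
        \<le> norm ((1 + 1 / h) *\<^sub>R x - (1 / h) *\<^sub>R S h x)"
      by (rule norm_triangle_ineq2)
    moreover have "norm ((1 + 1 / h) *\<^sub>R x) - norm ((1 / h) *\<^sub>R S h x)
        = norm x + (norm x - norm (S h x)) / h"
      using elim by (simp add: field_simps)
    moreover have "(norm x - norm (S h x)) / h \<ge> 0"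
      using contraction[of h x] elim by simp
    ultimately show ?case unfolding eq by linarith
  qed
  ultimately show ?thesis
    by (rule tendsto_lowerbound) simp
qed

text \<open>\<open>u (s + h)\<close> and \<open>S h (u s)\<close> have the same right derivative at
  \<open>h = 0\<close>, so they differ by less than \<open>e * h\<close> for small \<open>h\<close>,
  while \<open>S h\<close> does not increase the norm. This bounds the right Dini derivative of
  \<open>norm (u t)\<close>.\<close>

lemma right_solution_norm_le:
  assumes cont: "continuous_on {0..} u"
    and right: "\<And>t. t > 0 \<Longrightarrow> \<exists>g. (u t, g) \<in> sg_generator S \<and>
      ((\<lambda>h. (u (t + h) - u t) /\<^sub>R h) \<longlongrightarrow> g) (at_right 0)"
    and t: "t \<ge> 0"
  shows "norm (u t) \<le> norm (u 0)"
proof (rule right_Dini_nonincreasing[OF t])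
  show "continuous_on {0..t} (\<lambda>t. norm (u t))"
    using cont by (auto intro!: continuous_intros intro: continuous_on_subset)
  fix s e :: real assume s: "0 < s" "s < t" and e: "e > 0"
  obtain g where g: "((\<lambda>h. (S h (u s) - u s) /\<^sub>R h) \<longlongrightarrow> g) (at_right 0)"
      "((\<lambda>h. (u (s + h) - u s) /\<^sub>R h) \<longlongrightarrow> g) (at_right 0)"
    using right[OF s(1)] by (auto simp: sg_generator_def)
  have "((\<lambda>h. (u (s + h) - u s) /\<^sub>R h - (S h (u s) - u s) /\<^sub>R h) \<longlongrightarrow> 0) (at_right 0)"
    using tendsto_diff[OF g(2,1)] by simp
  then have "\<forall>\<^sub>F h in at_right 0. norm ((u (s + h) - u s) /\<^sub>R h - (S h (u s) - u s) /\<^sub>R h) < e"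
    using e by (auto dest: tendstoD)
  then show "\<forall>\<^sub>F h in at_right 0. norm (u (s + h)) \<le> norm (u s) + e * h"
    using eventually_at_right_less[of 0]
  proof eventually_elim
    case (elim h)
    have "(u (s + h) - u s) /\<^sub>R h - (S h (u s) - u s) /\<^sub>R h = (u (s + h) - S h (u s)) /\<^sub>R h"
      by (simp add: algebra_simps)
    with elim have "norm (u (s + h) - S h (u s)) / h < e"
      by (simp add: divide_inverse_commute)
    with elim have "norm (u (s + h) - S h (u s)) < e * h"
      by (simp add: pos_divide_less_eq)
    moreover have "norm (u (s + h)) \<le> norm (u (s + h) - S h (u s)) + norm (S h (u s))"
      using norm_triangle_ineq[of "u (s + h) - S h (u s)" "S h (u s)"] by simp
    ultimately show ?case using contraction[of h "u s"] elim by linarith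
  qed
qed

lemma right_solution_unique:
  assumes "continuous_on {0..} u" "continuous_on {0..} v"
    and "\<And>t. t > 0 \<Longrightarrow> \<exists>g. (u t, g) \<in> sg_generator S \<and>
      ((\<lambda>h. (u (t + h) - u t) /\<^sub>R h) \<longlongrightarrow> g) (at_right 0)"
    and "\<And>t. t > 0 \<Longrightarrow> \<exists>g. (v t, g) \<in> sg_generator S \<and>
      ((\<lambda>h. (v (t + h) - v t) /\<^sub>R h) \<longlongrightarrow> g) (at_right 0)"
    and "u 0 = v 0" and "t \<ge> 0"
  shows "u t = v t"
proof -
  have "norm (u t - v t) \<le> norm (u 0 - v 0)"
  proof (rule right_solution_norm_le[of "\<lambda>t. u t - v t"])
    show "continuous_on {0..} (\<lambda>t. u t - v t)"
      using assms by (intro continuous_intros)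
    fix t :: real assume "t > 0"
    from assms(3)[OF this] assms(4)[OF this] obtain g k
      where gk: "(u t, g) \<in> sg_generator S" "(v t, k) \<in> sg_generator S"
      "((\<lambda>h. (u (t + h) - u t) /\<^sub>R h) \<longlongrightarrow> g) (at_right 0)"
      "((\<lambda>h. (v (t + h) - v t) /\<^sub>R h) \<longlongrightarrow> k) (at_right 0)"
      by blast
    from tendsto_diff[OF gk(3,4)] sg_generator_diff[OF bl gk(1,2)]
    show "\<exists>g. (u t - v t, g) \<in> sg_generator S \<and>
        ((\<lambda>h. (u (t + h) - v (t + h) - (u t - v t)) /\<^sub>R h) \<longlongrightarrow> g) (at_right 0)"
      by (intro exI[of _ "g - k"]) (simp add: algebra_simps)
  qed (use \<open>t \<ge> 0\<close> in auto)
  with assms show ?thesis by simp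
qed

lemma orbit_unique:
  assumes "continuous_on {0..} u"
    and "\<And>t. t > 0 \<Longrightarrow> \<exists>g. (u t, g) \<in> sg_generator S \<and>
      ((\<lambda>h. (u (t + h) - u t) /\<^sub>R h) \<longlongrightarrow> g) (at_right 0)"
    and "(u 0, g) \<in> sg_generator S" and "t \<ge> 0"
  shows "u t = S t (u 0)"
proof (rule right_solution_unique[OF assms(1) continuous_orbit assms(2)])
  show "\<exists>g. (S t (u 0), g) \<in> sg_generator S \<and>
      ((\<lambda>h. (S (t + h) (u 0) - S t (u 0)) /\<^sub>R h) \<longlongrightarrow> g) (at_right 0)" if "t > 0" for t
    using generator_invariant[OF assms(3), of t] that by auto
qed (simp_all add: zero \<open>t \<ge> 0\<close>)

text \<open>Orbits of \<open>R\<close> that start in the common domain are right solutions for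
  \<open>S\<close>, so only the contractivity of \<open>S\<close> enters. Density and the continuity
  of each single operator give the rest. This is what pins down the indefinite choice in
  \<open>generated_semigroup\<close>.\<close>

lemma same_generator_unique:
  assumes "C0_sg R" and gen: "sg_generator R = sg_generator S"
    and dense: "closure (Domain (sg_generator S)) = UNIV" and t: "t \<ge> 0"
  shows "R t x = S t x"
proof -
  interpret R: C0_sg R by fact
  have "x \<in> closure (Domain (sg_generator S))" using dense by simp
  then obtain f where f: "\<And>n. f n \<in> Domain (sg_generator S)" "f \<longlonglongrightarrow> x"
    by (auto simp: closure_sequential)
  have "R t (f n) = S t (f n)" for n
  proof -
    obtain g where g: "(f n, g) \<in> sg_generator S" using f(1) by blast
    have "R t (f n) = S t (R 0 (f n))"
    proof (rule orbit_unique[OF R.continuous_orbit])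
      show "\<exists>g. (R t (f n), g) \<in> sg_generator S \<and>
          ((\<lambda>h. (R (t + h) (f n) - R t (f n)) /\<^sub>R h) \<longlongrightarrow> g) (at_right 0)" if "t > 0" for t
        using R.generator_invariant[OF g[folded gen], of t] that gen by auto
      show "(R 0 (f n), g) \<in> sg_generator S" using g by (simp add: R.zero)
    qed (rule t)
    then show ?thesis by (simp add: R.zero)
  qed
  moreover have "(\<lambda>n. R t (f n)) \<longlonglongrightarrow> R t x" "(\<lambda>n. S t (f n)) \<longlonglongrightarrow> S t x"
    by (rule bounded_linear.tendsto[OF R.bl[OF t] f(2)] bounded_linear.tendsto[OF bl[OF t] f(2)])+
  ultimately show ?thesis using LIMSEQ_unique by simp
qed

text \<open>For the left derivative the quotient is split into \<open>S (t - h)\<close> applied to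
  the remainder \<open>(S h x - x) /\<^sub>R h - g\<close>, which contractivity sends to 0, and
  \<open>S (t - h) g\<close>, which converges because the orbit of \<open>g\<close> is
  continuous.\<close>

lemma orbit_has_vector_derivative:
  assumes "(x, g) \<in> sg_generator S" "t > 0"
  shows "((\<lambda>t. S t x) has_vector_derivative S t g) (at t)"
proof -
  have small: "\<forall>\<^sub>F h in at_right 0. 0 < h \<and> h < t"
    using eventually_at_right_real[OF \<open>t > 0\<close>] by simp
  have g: "((\<lambda>h. (S h x - x) /\<^sub>R h - g) \<longlongrightarrow> 0) (at_right 0)"
    using assms(1) by (simp add: sg_generator_def LIM_zero_iff)
  have "\<forall>\<^sub>F h in at_right 0. norm (S (t - h) ((S h x - x) /\<^sub>R h - g)) \<le> norm ((S h x - x) /\<^sub>R h - g)"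
    using small by eventually_elim (rule contraction, simp)
  then have 1: "((\<lambda>h. S (t - h) ((S h x - x) /\<^sub>R h - g)) \<longlongrightarrow> 0) (at_right 0)"
    using tendsto_norm_zero[OF g] by (rule Lim_null_comparison)
  have 2: "((\<lambda>h. S (t - h) g) \<longlongrightarrow> S t g) (at_right 0)"
  proof (rule isCont_tendsto_compose[of _ "\<lambda>t. S t g"])
    have "continuous_on {0<..} (\<lambda>t. S t g)"
      using continuous_orbit[of g] by (rule continuous_on_subset) auto
    then show "isCont (\<lambda>t. S t g) t"
      using \<open>t > 0\<close> by (simp add: continuous_on_eq_continuous_at)
    show "((\<lambda>h. t - h) \<longlongrightarrow> t) (at_right 0)"
      by (auto intro!: tendsto_eq_intros)
  qed
  have "\<forall>\<^sub>F h in at_right 0. S (t - h) ((S h x - x) /\<^sub>R h - g) + S (t - h) g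
      = (S (t + - h) x - S t x) /\<^sub>R (- h)"
    using small
  proof eventually_elim
    case (elim h)
    then interpret T: bounded_linear "S (t - h)" using bl by simp
    have "S t x = S (t - h) (S h x)" using add[of "t - h" h x] elim by simp
    then show ?case by (simp add: T.diff T.scaleR scaleR_diff_right)
  qed
  with tendsto_add[OF 1 2]
  have "((\<lambda>h. (S (t + - h) x - S t x) /\<^sub>R (- h)) \<longlongrightarrow> S t g) (at_right 0)"
    by (simp add: tendsto_cong)
  then have "((\<lambda>h. (S (t + h) x - S t x) /\<^sub>R h) \<longlongrightarrow> S t g) (at_left 0)"
    by (subst filterlim_at_left_to_right) simp
  moreover have "((\<lambda>h. (S (t + h) x - S t x) /\<^sub>R h) \<longlongrightarrow> S t g) (at_right 0)"
    using generator_invariant[OF assms(1)] assms(2) by simp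
  ultimately show ?thesis
    unfolding has_vector_derivative_iff_quotient by (rule filterlim_split_at)
qed

text \<open>Mean value inequality for the curve \<open>S t x - t *\<^sub>R g\<close>, whose
  derivative is \<open>S t g - g\<close>.\<close>

lemma generator_estimate:
  assumes "(x, g) \<in> sg_generator S" "h > 0"
    and "\<And>s. 0 < s \<Longrightarrow> s < h \<Longrightarrow> norm (S s g - g) \<le> B"
  shows "norm (S h x - x - h *\<^sub>R g) \<le> B * h"
proof -
  have "norm ((S h x - h *\<^sub>R g) - (S 0 x - 0 *\<^sub>R g)) \<le> B * h - B * 0"
  proof (rule differentiable_bound_general[OF assms(2)])
    show "continuous_on {0..h} (\<lambda>t. S t x - t *\<^sub>R g)"
      by (intro continuous_intros continuous_on_subset[OF continuous_orbit]) auto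
    show "continuous_on {0..h} (\<lambda>t. B * t)"
      by (intro continuous_intros)
    fix t assume t: "0 < t" "t < h"
    show "((\<lambda>t. S t x - t *\<^sub>R g) has_vector_derivative S t g - g) (at t)"
      by (auto intro!: derivative_eq_intros orbit_has_vector_derivative[OF assms(1) t(1)])
    show "((\<lambda>t. B * t) has_vector_derivative B) (at t)"
      by (auto intro!: derivative_eq_intros simp flip: has_real_derivative_iff_has_vector_derivative)
    show "norm (S t g - g) \<le> B" using assms(3) t .
  qed
  then show ?thesis by (simp add: zero algebra_simps)
qed

text \<open>At fixed \<open>h\<close> the estimate survives the limit in \<open>n\<close>: passing
  from \<open>g\<close> to \<open>g' n\<close> costs \<open>norm (g' n - g)\<close> twice, once for
  the vector itself and once for its image, by contractivity. Only afterwards does \<open>h\<close>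
  tend to 0.\<close>

lemma closed_generator: "closed (sg_generator S)"
  unfolding closed_sequential_limits
proof (intro allI impI, elim conjE)
  fix z l assume z: "\<forall>n. z n \<in> sg_generator S" and lim: "z \<longlonglongrightarrow> l"
  obtain x g where l: "l = (x, g)" by fastforce
  define x' g' where "x' n = fst (z n)" and "g' n = snd (z n)" for n
  have gen: "(x' n, g' n) \<in> sg_generator S" for n
    using z by (simp add: x'_def g'_def)
  have lims: "x' \<longlonglongrightarrow> x" "g' \<longlonglongrightarrow> g"
    using tendsto_fst[OF lim] tendsto_snd[OF lim] by (simp_all add: x'_def[abs_def] g'_def[abs_def] l)
  have est: "norm (S h x - x - h *\<^sub>R g) \<le> B * h"
    if h: "h > 0" and B: "\<And>s. 0 < s \<Longrightarrow> s < h \<Longrightarrow> norm (S s g - g) \<le> B" for h B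
  proof (rule LIMSEQ_le)
    show "(\<lambda>n. norm (S h (x' n) - x' n - h *\<^sub>R g' n)) \<longlonglongrightarrow> norm (S h x - x - h *\<^sub>R g)"
      using h by (intro tendsto_intros lims bounded_linear.tendsto[OF bl]) auto
    show "(\<lambda>n. (B + 2 * norm (g' n - g)) * h) \<longlonglongrightarrow> B * h"
      by (rule tendsto_eq_intros refl tendsto_norm_zero LIM_zero lims)+ simp
    have "norm (S h (x' n) - x' n - h *\<^sub>R g' n) \<le> (B + 2 * norm (g' n - g)) * h" for n
    proof (rule generator_estimate[OF gen h])
      fix s assume s: "0 < s" "s < h"
      have eq: "S s (g' n) - g' n = S s (g' n - g) + (S s g - g) - (g' n - g)"
        using s by (simp add: diff)
      have "norm (S s (g' n) - g' n) \<le> norm (S s (g' n - g)) + norm (S s g - g) + norm (g' n - g)"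
        unfolding eq by (meson add_right_mono norm_triangle_ineq norm_triangle_ineq4 order_trans)
      then show "norm (S s (g' n) - g' n) \<le> B + 2 * norm (g' n - g)"
        using contraction[of s "g' n - g"] B[OF s] s by linarith
    qed
    then show "\<exists>N. \<forall>n\<ge>N. norm (S h (x' n) - x' n - h *\<^sub>R g' n) \<le> (B + 2 * norm (g' n - g)) * h"
      by blast
  qed
  have "((\<lambda>h. (S h x - x) /\<^sub>R h) \<longlongrightarrow> g) (at_right 0)"
  proof (rule tendstoI)
    fix e :: real assume e: "e > 0"
    then have "\<forall>\<^sub>F s in at_right 0. dist (S s g) g < e / 2"
      by (intro tendstoD[OF cont0]) simp
    then obtain d where d: "d > 0" "\<And>s. 0 < s \<Longrightarrow> s < d \<Longrightarrow> norm (S s g - g) < e / 2"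
      by (auto simp: eventually_at_right_field dist_norm)
    show "\<forall>\<^sub>F h in at_right 0. dist ((S h x - x) /\<^sub>R h) g < e"
      using eventually_at_right_real[OF d(1)]
    proof eventually_elim
      case (elim h)
      then have h: "0 < h" "h < d" by auto
      have eq: "(S h x - x) /\<^sub>R h - g = (S h x - x - h *\<^sub>R g) /\<^sub>R h"
        using h by (simp add: scaleR_diff_right)
      have "norm (S h x - x - h *\<^sub>R g) \<le> (e / 2) * h"
        using d h by (intro est) (auto intro!: less_imp_le)
      also have "\<dots> < e * h" using h e by simp
      finally show ?case
        unfolding dist_norm eq using h by (simp add: pos_divide_less_eq divide_inverse_commute[symmetric])
    qed
  qed
  then show "l \<in> sg_generator S" by (simp add: l sg_generator_def)
qed

text \<open>Dissipativity turns approximation of \<open>x - g\<close> into approximation of \<open>x\<close> and \<open>g\<close> separately.\<close>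

lemma generator_eq_closure:
  assumes sub: "C \<subseteq> sg_generator S" and range: "closure {x - g | x g. (x, g) \<in> C} = UNIV"
  shows "sg_generator S = closure C"
proof
  show "closure C \<subseteq> sg_generator S"
    using sub closed_generator by (rule closure_minimal)
  show "sg_generator S \<subseteq> closure C"
  proof clarify
    fix x g assume xg: "(x, g) \<in> sg_generator S"
    have "x - g \<in> closure {x - g | x g. (x, g) \<in> C}" using range by simp
    then obtain z where z: "\<And>n. z n \<in> {x - g | x g. (x, g) \<in> C}" "z \<longlonglongrightarrow> x - g"
      by (auto simp: closure_sequential)
    then have "\<forall>n. \<exists>y k. (y, k) \<in> C \<and> z n = y - k" by blast
    then obtain y k where yk: "\<And>n. (y n, k n) \<in> C" "\<And>n. z n = y n - k n" by metis
    have le: "norm (y n - x) \<le> norm (z n - (x - g))" for n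
    proof -
      have "norm (y n - x) \<le> norm (y n - x - (k n - g))"
        using sub yk(1) by (intro dissipative sg_generator_diff[OF bl _ xg]) auto
      then show ?thesis by (simp add: yk(2) algebra_simps)
    qed
    have y: "y \<longlonglongrightarrow> x"
    proof (rule LIM_zero_cancel, rule Lim_null_comparison)
      show "(\<lambda>n. norm (z n - (x - g))) \<longlonglongrightarrow> 0"
        using z(2) by (intro tendsto_norm_zero LIM_zero)
    qed (use le in simp)
    moreover have "k \<longlonglongrightarrow> g"
    proof -
      have "(\<lambda>n. y n - z n) \<longlonglongrightarrow> x - (x - g)" using y z(2) by (rule tendsto_diff)
      then show ?thesis by (simp add: yk(2))
    qed
    ultimately have "(\<lambda>n. (y n, k n)) \<longlonglongrightarrow> (x, g)" by (rule tendsto_Pair)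
    then show "(x, g) \<in> closure C"
      unfolding closure_sequential using yk(1) by (intro exI[of _ "\<lambda>n. (y n, k n)"]) simp
  qed
qed

end

section \<open>Semigroups whose laws are checked on a dense set\<close>

lemma bounded_linear_eq_on_dense:
  fixes f g :: "'a::real_normed_vector \<Rightarrow> 'b::real_normed_vector"
  assumes f: "bounded_linear f" and g: "bounded_linear g"
    and dense: "closure D = UNIV" and eq: "\<And>x. x \<in> D \<Longrightarrow> f x = g x"
  shows "f x = g x"
proof -
  obtain y where y: "\<forall>n. y n \<in> D" "y \<longlonglongrightarrow> x"
    using dense closure_sequential[of x D] by auto
  have "(\<lambda>n. f (y n)) \<longlonglongrightarrow> f x" "(\<lambda>n. g (y n)) \<longlonglongrightarrow> g x"
    by (rule bounded_linear.tendsto[OF f y(2)] bounded_linear.tendsto[OF g y(2)])+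
  then show ?thesis using eq y(1) LIMSEQ_unique by simp
qed

text \<open>The algebraic laws extend by continuity of each operator. Strong continuity at 0 needs
  the uniform bound \<open>contr\<close>: the distance of \<open>S t x\<close> from
  \<open>S t y\<close> is at most that of \<open>x\<close> from \<open>y\<close>, for all
  \<open>t\<close> at once.\<close>

lemma contraction_sg_dense:
  fixes S :: "real \<Rightarrow> 'a \<Rightarrow> 'a::real_normed_vector"
  assumes bl: "\<And>t. t \<ge> 0 \<Longrightarrow> bounded_linear (S t)"
    and contr: "\<And>t x. t \<ge> 0 \<Longrightarrow> norm (S t x) \<le> norm x"
    and dense: "closure D = UNIV"
    and zero: "\<And>x. x \<in> D \<Longrightarrow> S 0 x = x"
    and add: "\<And>s t x. s \<ge> 0 \<Longrightarrow> t \<ge> 0 \<Longrightarrow> x \<in> D \<Longrightarrow> S (s + t) x = S s (S t x)"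
    and cont: "\<And>x. x \<in> D \<Longrightarrow> ((\<lambda>t. S t x) \<longlongrightarrow> x) (at_right 0)"
  shows "contraction_sg S"
proof -
  note ext = bounded_linear_eq_on_dense[OF _ _ dense]
  show ?thesis
  proof (intro contraction_sg.intro C0_sg.intro contraction_sg_axioms.intro)
    show "S 0 x = x" for x
      using ext[OF bl bounded_linear_ident zero] by simp
    show "S (s + t) x = S s (S t x)" if "s \<ge> 0" "t \<ge> 0" for s t x
      using ext[OF bl bounded_linear_compose[OF bl bl] add] that by simp
    show "((\<lambda>t. S t x) \<longlongrightarrow> x) (at_right 0)" for x
    proof (rule tendstoI)
      fix e :: real assume e: "e > 0"
      obtain y where y: "y \<in> D" "dist y x < e / 3"
        using dense e closure_approachable[of x D] by (metis UNIV_I divide_pos_pos zero_less_numeral)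
      have "\<forall>\<^sub>F t in at_right 0. dist (S t y) y < e / 3"
        using cont[OF y(1)] e by (intro tendstoD) auto
      then show "\<forall>\<^sub>F t in at_right 0. dist (S t x) x < e"
        using eventually_at_right_less[of 0]
      proof eventually_elim
        case (elim t)
        then have "dist (S t x) (S t y) \<le> dist x y"
          using contr[of t "x - y"] linear_diff[OF bounded_linear.linear[OF bl[of t]]]
          by (simp add: dist_norm)
        then show ?case
          using elim y(2) dist_triangle[of "S t x" x "S t y"] dist_triangle[of "S t y" x y]
          by (simp add: dist_commute)
      qed
    qed
  qed (rule bl contr, assumption)+
qed

section \<open>The weighted sequence space as a normed space\<close>

typedef ell1 = "l1w (\<lambda>_. 1)"
  by (rule exI[of _ "\<lambda>_. 0"]) (simp add: l1w_def)

setup_lifting type_definition_ell1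

instantiation ell1 :: real_vector
begin

lift_definition zero_ell1 :: ell1 is "\<lambda>_. 0"
  by (simp add: l1w_def)

lift_definition plus_ell1 :: "ell1 \<Rightarrow> ell1 \<Rightarrow> ell1" is "\<lambda>f g n. f n + g n"
proof -
  fix f g :: "nat \<Rightarrow> real" assume "f \<in> l1w (\<lambda>_. 1)" "g \<in> l1w (\<lambda>_. 1)"
  then have "(\<lambda>n. f n - - g n) \<in> l1w (\<lambda>_. 1)"
    by (intro l1w_diff) (simp_all add: l1w_def)
  then show "(\<lambda>n. f n + g n) \<in> l1w (\<lambda>_. 1)" by simp
qed

lift_definition minus_ell1 :: "ell1 \<Rightarrow> ell1 \<Rightarrow> ell1" is "\<lambda>f g n. f n - g n"
  by (rule l1w_diff) auto

lift_definition uminus_ell1 :: "ell1 \<Rightarrow> ell1" is "\<lambda>f n. - f n"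
  by (simp add: l1w_def)

lift_definition scaleR_ell1 :: "real \<Rightarrow> ell1 \<Rightarrow> ell1" is "\<lambda>c f n. c * f n"
  by (simp add: l1w_def abs_mult summable_mult)

instance
  by standard (transfer, simp add: algebra_simps)+

end

instantiation ell1 :: real_normed_vector
begin

lift_definition norm_ell1 :: "ell1 \<Rightarrow> real" is "norm_w (\<lambda>_. 1)" .

definition "sgn_ell1 x = x /\<^sub>R norm x" for x :: ell1

definition "dist_ell1 x y = norm (x - y)" for x y :: ell1

definition "uniformity_ell1 = (INF e\<in>{0 <..}. principal {(x :: ell1, y). dist x y < e})"

definition "open_ell1 U \<longleftrightarrow> (\<forall>x\<in>U. \<forall>\<^sub>F (x', y) in uniformity. x' = x \<longrightarrow> y \<in> U)" for U :: "ell1 set"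

instance
proof
  fix x y :: ell1 and c :: real
  show "norm x = 0 \<longleftrightarrow> x = 0"
  proof transfer
    fix f :: "nat \<Rightarrow> real" assume "f \<in> l1w (\<lambda>_. 1)"
    then show "norm_w (\<lambda>_. 1) f = 0 \<longleftrightarrow> f = (\<lambda>_. 0)"
      by (auto simp: l1w_def norm_w_def suminf_eq_zero_iff)
  qed
  show "norm (c *\<^sub>R x) = \<bar>c\<bar> * norm x"
    by transfer (simp add: l1w_def norm_w_def abs_mult suminf_mult)
  show "norm (x + y) \<le> norm x + norm y"
  proof transfer
    fix f g :: "nat \<Rightarrow> real" assume "f \<in> l1w (\<lambda>_. 1)" "g \<in> l1w (\<lambda>_. 1)"
    then have fg: "summable (\<lambda>n. \<bar>f n\<bar>)" "summable (\<lambda>n. \<bar>g n\<bar>)"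
      by (simp_all add: l1w_def)
    have "summable (\<lambda>n. \<bar>f n + g n\<bar>)"
      by (rule summable_comparison_test'[OF summable_add[OF fg]]) simp
    then have "(\<Sum>n. \<bar>f n + g n\<bar>) \<le> (\<Sum>n. \<bar>f n\<bar> + \<bar>g n\<bar>)"
      by (intro suminf_le abs_triangle_ineq summable_add fg)
    then show "norm_w (\<lambda>_. 1) (\<lambda>n. f n + g n) \<le> norm_w (\<lambda>_. 1) f + norm_w (\<lambda>_. 1) g"
      using suminf_add[OF fg] by (simp add: norm_w_def)
  qed
qed (simp_all add: sgn_ell1_def dist_ell1_def uniformity_ell1_def open_ell1_def)

end

text \<open>
  A type cannot depend on \<open>w\<close>, so \<^term>\<open>l1w w\<close> is identified with the unweighted type
  \<^typ>\<open>ell1\<close> through \<open>f \<mapsto> (w\<^sub>n f\<^sub>n)\<close>.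
\<close>

definition of_ell1 :: "(nat \<Rightarrow> real) \<Rightarrow> ell1 \<Rightarrow> nat \<Rightarrow> real" where
  "of_ell1 w x = (\<lambda>n. Rep_ell1 x n / w n)"

definition to_ell1 :: "(nat \<Rightarrow> real) \<Rightarrow> (nat \<Rightarrow> real) \<Rightarrow> ell1" where
  "to_ell1 w f = Abs_ell1 (\<lambda>n. w n * f n)"

locale weight =
  fixes w :: "nat \<Rightarrow> real"
  assumes weight_pos: "\<forall>n\<ge>1. 0 < w n"
begin

lemma Rep_ell1_0: "Rep_ell1 x 0 = 0"
  using Rep_ell1[of x] by (simp add: l1w_def)

lemma summable_Rep_ell1: "summable (\<lambda>n. \<bar>Rep_ell1 x n\<bar>)"
  using Rep_ell1[of x] by (simp add: l1w_def)

text \<open>\<open>w 0\<close> is arbitrary and may be 0, so index 0 needs its own case throughout;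
  there both sides vanish because \<open>Rep_ell1 x 0 = 0\<close>.\<close>

lemma w_times_of_ell1: "w n * of_ell1 w x n = Rep_ell1 x n"
  using weight_pos[rule_format, of n] by (cases "n = 0") (auto simp: of_ell1_def Rep_ell1_0)

lemma w_times_abs_of_ell1: "w n * \<bar>of_ell1 w x n\<bar> = \<bar>Rep_ell1 x n\<bar>"
  using weight_pos[rule_format, of n] by (cases "n = 0") (auto simp: of_ell1_def Rep_ell1_0)

lemma of_ell1_in [simp]: "of_ell1 w x \<in> l1w w"
  unfolding l1w_def mem_Collect_eq w_times_abs_of_ell1 using summable_Rep_ell1
  by (simp add: of_ell1_def Rep_ell1_0)

lemma norm_w_of_ell1 [simp]: "norm_w w (of_ell1 w x) = norm x"
  unfolding norm_w_def w_times_abs_of_ell1 norm_ell1.rep_eq by simp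

lemma w_abs: "f \<in> l1w w \<Longrightarrow> \<bar>w n * f n\<bar> = w n * \<bar>f n\<bar>"
  using weight_pos[rule_format, of n] by (cases "n = 0") (auto simp: l1w_def abs_mult)

lemma Rep_to_ell1: "f \<in> l1w w \<Longrightarrow> Rep_ell1 (to_ell1 w f) n = w n * f n"
proof -
  assume f: "f \<in> l1w w"
  have "(\<lambda>n. w n * f n) \<in> l1w (\<lambda>_. 1)"
    using f unfolding l1w_def mem_Collect_eq by (simp add: w_abs[OF f])
  then show ?thesis by (simp add: to_ell1_def Abs_ell1_inverse)
qed

lemma of_to_ell1 [simp]: "f \<in> l1w w \<Longrightarrow> of_ell1 w (to_ell1 w f) = f"
proof
  fix n assume f: "f \<in> l1w w"
  show "of_ell1 w (to_ell1 w f) n = f n"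
    using weight_pos[rule_format, of n] f
    by (cases "n = 0") (auto simp: of_ell1_def Rep_to_ell1, auto simp: l1w_def)
qed

lemma to_of_ell1 [simp]: "to_ell1 w (of_ell1 w x) = x"
  by (simp add: to_ell1_def w_times_of_ell1 Rep_ell1_inverse)

lemma norm_to_ell1: "f \<in> l1w w \<Longrightarrow> norm (to_ell1 w f) = norm_w w f"
  using norm_w_of_ell1[of "to_ell1 w f"] by simp

lemma inj_of_ell1: "of_ell1 w x = of_ell1 w y \<longleftrightarrow> x = y"
  by (metis to_of_ell1)

lemma of_ell1_add: "of_ell1 w (x + y) = (\<lambda>n. of_ell1 w x n + of_ell1 w y n)"
  by (simp add: of_ell1_def plus_ell1.rep_eq add_divide_distrib)

lemma of_ell1_diff: "of_ell1 w (x - y) = (\<lambda>n. of_ell1 w x n - of_ell1 w y n)"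
  by (simp add: of_ell1_def minus_ell1.rep_eq diff_divide_distrib)

lemma of_ell1_scaleR: "of_ell1 w (c *\<^sub>R x) = (\<lambda>n. c * of_ell1 w x n)"
  by (simp add: of_ell1_def scaleR_ell1.rep_eq)

lemma of_ell1_quotient:
  "of_ell1 w ((x - y) /\<^sub>R h) = (\<lambda>n. (of_ell1 w x n - of_ell1 w y n) / h)"
  by (simp add: of_ell1_scaleR of_ell1_diff divide_inverse_commute)

lemma l1w_cases:
  assumes "f \<in> l1w w" obtains x where "f = of_ell1 w x"
  using assms of_to_ell1 by metis

lemma dist_w_of_ell1: "dist_w w (of_ell1 w x) (of_ell1 w y) = dist x y"
  using norm_w_of_ell1[of "x - y"] by (simp add: dist_w_def dist_norm of_ell1_diff)

sublocale l1w: Metric_space "l1w w" "dist_w w"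
  by (rule Metric_space_l1w[OF weight_pos])

section \<open>Transfer of limits, closures and semigroups between \<open>l1w w\<close> and
  \<open>ell1\<close>\<close>

lemma limitin_of_ell1:
  "limitin (top_w w) (\<lambda>x. of_ell1 w (f x)) (of_ell1 w l) F \<longleftrightarrow> (f \<longlongrightarrow> l) F"
  by (simp add: top_w_def l1w.limitin_metric dist_w_of_ell1 tendsto_iff)

lemma limitin_in_l1w:
  assumes "limitin (top_w w) f l F" shows "l \<in> l1w w"
  using assms by (simp add: top_w_def l1w.limitin_metric)

lemma limitin_cong:
  assumes "\<forall>\<^sub>F x in F. f x = g x"
  shows "limitin X f l F \<longleftrightarrow> limitin X g l F"
proof
  show "limitin X g l F" if "limitin X f l F"
    using assms that by (rule limitin_transform_eventually)
  have "\<forall>\<^sub>F x in F. g x = f x" using assms by (rule eventually_mono) simp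
  then show "limitin X f l F" if "limitin X g l F"
    using that by (rule limitin_transform_eventually)
qed

text \<open>\<open>op_closure\<close> lives in a product topology, where a homeomorphism of the
  factors transfers more directly than the metric.\<close>

lemma homeomorphic_maps_of_ell1: "homeomorphic_maps euclidean (top_w w) (of_ell1 w) (to_ell1 w)"
proof -
  have "continuous_map Met_TC.mtopology l1w.mtopology (of_ell1 w)"
    unfolding Met_TC.metric_continuous_map[OF l1w.Metric_space_axioms]
    by (auto simp: dist_w_of_ell1)
  moreover have "continuous_map l1w.mtopology Met_TC.mtopology (to_ell1 w)"
    unfolding l1w.metric_continuous_map[OF Met_TC.Metric_space_axioms]
    by (auto elim!: l1w_cases simp: dist_w_of_ell1)
  ultimately show ?thesis
    by (simp add: homeomorphic_maps_def top_w_def)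
qed

text \<open>Agreement is asked on \<open>T\<close> only, because a classical solution is arbitrary
  at negative times, where it may even leave \<open>l1w w\<close>.\<close>

lemma continuous_map_top_w:
  assumes "\<And>t. t \<in> T \<Longrightarrow> u t = of_ell1 w (v t)"
  shows "continuous_map (top_of_set T) (top_w w) u \<longleftrightarrow> continuous_on T v"
proof
  assume "continuous_map (top_of_set T) (top_w w) u"
  then have "continuous_map (top_of_set T) euclidean (to_ell1 w \<circ> u)"
    using homeomorphic_maps_of_ell1 unfolding homeomorphic_maps_def
    by (blast intro: continuous_map_compose)
  then show "continuous_on T v"
    by (simp add: assms cong: continuous_on_cong)
next
  assume "continuous_on T v"
  then have "continuous_map (top_of_set T) euclidean v" by simp
  then have "continuous_map (top_of_set T) (top_w w) (of_ell1 w \<circ> v)"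
    using homeomorphic_maps_of_ell1 unfolding homeomorphic_maps_def
    by (blast intro: continuous_map_compose)
  then show "continuous_map (top_of_set T) (top_w w) u"
    by (rule continuous_map_eq) (simp add: assms)
qed

lemma op_closure_eq:
  "op_closure w (map_prod (of_ell1 w) (of_ell1 w) ` P) = map_prod (of_ell1 w) (of_ell1 w) ` closure P"
proof -
  have "homeomorphic_map (prod_topology euclidean euclidean) (prod_topology (top_w w) (top_w w))
      (map_prod (of_ell1 w) (of_ell1 w))"
    unfolding map_prod_def
    by (rule homeomorphic_maps_imp_map[OF homeomorphic_maps_prod[THEN iffD2, OF disjI2]])
      (rule conjI homeomorphic_maps_of_ell1)+
  from homeomorphic_map_closure_of[OF this, of P]
  show ?thesis by (simp add: op_closure_def)
qed

definition ell1_family :: "op_family \<Rightarrow> real \<Rightarrow> ell1 \<Rightarrow> ell1" where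
  "ell1_family S t x = to_ell1 w (S t (of_ell1 w x))"

lemma of_ell1_family:
  assumes "C0_semigroup w S" "t \<ge> 0"
  shows "of_ell1 w (ell1_family S t x) = S t (of_ell1 w x)"
  using assms by (simp add: ell1_family_def C0_semigroup_def bounded_linear_on_l1w_def)

lemma C0_sg_ell1_family:
  assumes S: "C0_semigroup w S"
  shows "C0_sg (ell1_family S)"
proof
  note family = of_ell1_family[OF S]
  fix t :: real assume t: "t \<ge> 0"
  then have lin: "bounded_linear_on_l1w w (S t)" using S by (simp add: C0_semigroup_def)
  show "ell1_family S t (x + y) = ell1_family S t x + ell1_family S t y" for x y
  proof -
    have "of_ell1 w (ell1_family S t (x + y)) = of_ell1 w (ell1_family S t x + ell1_family S t y)"
      using lin unfolding of_ell1_add family[OF t] bounded_linear_on_l1w_def by (intro ext) simp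
    then show ?thesis by (simp only: inj_of_ell1)
  qed
  show "ell1_family S t (c *\<^sub>R x) = c *\<^sub>R ell1_family S t x" for c x
  proof -
    have "of_ell1 w (ell1_family S t (c *\<^sub>R x)) = of_ell1 w (c *\<^sub>R ell1_family S t x)"
      using lin unfolding of_ell1_scaleR family[OF t] bounded_linear_on_l1w_def by (intro ext) simp
    then show ?thesis by (simp only: inj_of_ell1)
  qed
  obtain C where C: "\<And>f. f \<in> l1w w \<Longrightarrow> norm_w w (S t f) \<le> C * norm_w w f"
    using lin unfolding bounded_linear_on_l1w_def by blast
  have "norm (ell1_family S t x) \<le> norm x * C" for x
    using C[of "of_ell1 w x"] family[OF t, of x] norm_w_of_ell1[of "ell1_family S t x"]
    by (simp add: mult.commute)
  then show "\<exists>K. \<forall>x. norm (ell1_family S t x) \<le> norm x * K" by blast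
next
  note family = of_ell1_family[OF S]
  show "ell1_family S 0 x = x" for x
    using S by (simp add: ell1_family_def C0_semigroup_def)
  show "ell1_family S (s + t) x = ell1_family S s (ell1_family S t x)" if "s \<ge> 0" "t \<ge> 0" for s t x
    using S that family[of t x] by (simp add: ell1_family_def[of S "s + t"] ell1_family_def[of S s]
        C0_semigroup_def)
  show "((\<lambda>t. ell1_family S t x) \<longlongrightarrow> x) (at_right 0)" for x
  proof -
    have "limitin (top_w w) (\<lambda>t. S t (of_ell1 w x)) (of_ell1 w x) (at_right 0)"
      using S by (simp add: C0_semigroup_def)
    moreover have "\<forall>\<^sub>F t in at_right 0. S t (of_ell1 w x) = of_ell1 w (ell1_family S t x)"
      using eventually_at_right_less[of 0] by eventually_elim (simp add: family)
    ultimately show ?thesis using limitin_of_ell1 limitin_cong by fast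
  qed
qed

lemma generator_eq:
  assumes S: "C0_semigroup w S"
  shows "generator w S = map_prod (of_ell1 w) (of_ell1 w) ` sg_generator (ell1_family S)"
proof -
  have iff: "(of_ell1 w x, of_ell1 w g) \<in> generator w S \<longleftrightarrow> (x, g) \<in> sg_generator (ell1_family S)"
    for x g
  proof -
    have "\<forall>\<^sub>F h in at_right 0. (\<lambda>n. (S h (of_ell1 w x) n - of_ell1 w x n) / h)
        = of_ell1 w ((ell1_family S h x - x) /\<^sub>R h)"
      using eventually_at_right_less[of 0]
      by eventually_elim (simp add: of_ell1_quotient of_ell1_family[OF S])
    from limitin_cong[OF this, of "top_w w" "of_ell1 w g"] show ?thesis
      by (simp add: generator_def sg_generator_def limitin_of_ell1)
  qed
  \<comment> \<open>A limit in \<open>top_w w\<close> lies in the carrier, so both components of a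
    pair in \<open>generator w S\<close> can be pulled back to \<open>ell1\<close>.\<close>
  have sub: "generator w S \<subseteq> range (map_prod (of_ell1 w) (of_ell1 w))"
  proof
    fix p assume "p \<in> generator w S"
    then obtain f g where p: "p = (f, g)" "f \<in> l1w w" "g \<in> l1w w"
      by (auto simp: generator_def dest: limitin_in_l1w)
    then have "p = map_prod (of_ell1 w) (of_ell1 w) (to_ell1 w f, to_ell1 w g)" by simp
    then show "p \<in> range (map_prod (of_ell1 w) (of_ell1 w))" by (rule range_eqI)
  qed
  have iff': "map_prod (of_ell1 w) (of_ell1 w) q \<in> generator w S \<longleftrightarrow> q \<in> sg_generator (ell1_family S)"
    for q by (cases q) (simp add: iff)
  show ?thesis
  proof (intro equalityI subsetI)
    fix p assume p: "p \<in> generator w S"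
    with sub obtain q where "p = map_prod (of_ell1 w) (of_ell1 w) q" by (elim subsetD[THEN rangeE])
    with p iff' show "p \<in> map_prod (of_ell1 w) (of_ell1 w) ` sg_generator (ell1_family S)" by simp
  qed (auto simp: iff)
qed

text \<open>Transport in the direction opposite to \<open>C0_sg_ell1_family\<close>; it supplies the
  witness for the choice in \<open>generated_semigroup\<close>.\<close>

lemma C0_semigroup_of_C0_sg:
  assumes "C0_sg T"
  shows "C0_semigroup w (\<lambda>t f. of_ell1 w (T t (to_ell1 w f)))" (is "C0_semigroup w ?S")
  unfolding C0_semigroup_def
proof (intro conjI allI ballI impI)
  interpret T: C0_sg T by fact
  show "bounded_linear_on_l1w w (?S t)" if t: "t \<ge> 0" for t
  proof -
    interpret Tt: bounded_linear "T t" using T.bl t .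
    obtain K where K: "\<And>x. norm (T t x) \<le> norm x * K" using Tt.bounded by blast
    have "to_ell1 w (\<lambda>m. of_ell1 w x m + of_ell1 w y m) = x + y" for x y
      by (simp flip: of_ell1_add)
    moreover have "to_ell1 w (\<lambda>m. c * of_ell1 w x m) = c *\<^sub>R x" for c x
      by (simp flip: of_ell1_scaleR)
    ultimately show ?thesis
      unfolding bounded_linear_on_l1w_def
      by (auto elim!: l1w_cases simp: Tt.add Tt.scaleR of_ell1_add of_ell1_scaleR
          intro!: exI[of _ K] K[unfolded mult.commute[of _ K]])
  qed
  show "?S 0 f = f" if "f \<in> l1w w" for f
    using that by (simp add: T.zero)
  show "?S (s + t) f = ?S s (?S t f)" if "s \<ge> 0" "t \<ge> 0" for s t f
    using that by (simp add: T.add)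
  show "limitin (top_w w) (\<lambda>t. ?S t f) f (at_right 0)" if "f \<in> l1w w" for f
    using that by (auto elim!: l1w_cases simp: limitin_of_ell1 T.cont0)
qed

lemma has_derivative_w_of_ell1:
  assumes u: "\<And>s. s > 0 \<Longrightarrow> u s = of_ell1 w (v s)" and t: "t > 0"
  shows "has_derivative_w w u (of_ell1 w g) t \<longleftrightarrow> (v has_vector_derivative g) (at t)"
proof -
  \<comment> \<open>The two-sided quotient at \<open>t > 0\<close> sees only positive times once
    \<open>h > - t\<close>, which is where \<open>u\<close> and \<open>v\<close> are
    related.\<close>
  have "\<forall>\<^sub>F h in at 0. h > - t"
    using t eventually_at_topological[of "\<lambda>h. h > - t" 0 UNIV] open_greaterThan[of "- t"]
    by (metis greaterThan_iff neg_less_0_iff_less)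
  then have "\<forall>\<^sub>F h in at 0. (\<lambda>n. (u (t + h) n - u t n) / h)
      = of_ell1 w ((v (t + h) - v t) /\<^sub>R h)"
    by eventually_elim (use t in \<open>simp add: u of_ell1_quotient\<close>)
  from limitin_cong[OF this, of "top_w w" "of_ell1 w g"] show ?thesis
    by (simp add: has_derivative_w_def has_vector_derivative_iff_quotient limitin_of_ell1)
qed

lemma classical_solution_iff:
  assumes u: "\<And>t. t \<ge> 0 \<Longrightarrow> u t = of_ell1 w (v t)"
  shows "classical_solution w (map_prod (of_ell1 w) (of_ell1 w) ` G) u0 u \<longleftrightarrow>
    continuous_on {0..} v \<and>
    (\<exists>v'. continuous_on {0<..} v' \<and> (\<forall>t>0. (v has_vector_derivative v' t) (at t) \<and> (v t, v' t) \<in> G)) \<and>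
    u 0 = u0"
proof -
  have G: "(of_ell1 w x, of_ell1 w g) \<in> map_prod (of_ell1 w) (of_ell1 w) ` G \<longleftrightarrow> (x, g) \<in> G" for x g
    by (auto simp: inj_of_ell1)
  note D = has_derivative_w_of_ell1[of u v, OF u]
  have "(\<exists>u'. continuous_map (top_of_set {0<..}) (top_w w) u' \<and>
      (\<forall>t>0. has_derivative_w w u (u' t) t \<and> (u t, u' t) \<in> map_prod (of_ell1 w) (of_ell1 w) ` G))
    \<longleftrightarrow> (\<exists>v'. continuous_on {0<..} v' \<and> (\<forall>t>0. (v has_vector_derivative v' t) (at t) \<and> (v t, v' t) \<in> G))"
    (is "?L \<longleftrightarrow> ?R")
  proof
    assume ?L
    then obtain u' where u': "continuous_map (top_of_set {0<..}) (top_w w) u'"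
      "\<And>t. t > 0 \<Longrightarrow> has_derivative_w w u (u' t) t"
      "\<And>t. t > 0 \<Longrightarrow> (u t, u' t) \<in> map_prod (of_ell1 w) (of_ell1 w) ` G" by blast
    define v' where "v' t = to_ell1 w (u' t)" for t
    have v': "u' t = of_ell1 w (v' t)" if "t > 0" for t
      using u'(3)[OF that] by (auto simp: v'_def)
    have "continuous_on {0<..} v'"
      using u'(1) continuous_map_top_w[of "{0<..}" u' v'] v' by simp
    moreover have "(v has_vector_derivative v' t) (at t) \<and> (v t, v' t) \<in> G" if "t > 0" for t
      using u'(2,3)[OF that] D[of t "v' t"] G[of "v t" "v' t"] v'[OF that] u[of t] that by simp
    ultimately show ?R by blast
  next
    assume ?R
    then obtain v' where v': "continuous_on {0<..} v'"
      "\<And>t. t > 0 \<Longrightarrow> (v has_vector_derivative v' t) (at t)" "\<And>t. t > 0 \<Longrightarrow> (v t, v' t) \<in> G" by blast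
    have "continuous_map (top_of_set {0<..}) (top_w w) (\<lambda>t. of_ell1 w (v' t))"
      using v'(1) continuous_map_top_w[of "{0<..}" "\<lambda>t. of_ell1 w (v' t)" v'] by simp
    moreover have "has_derivative_w w u (of_ell1 w (v' t)) t \<and>
        (u t, of_ell1 w (v' t)) \<in> map_prod (of_ell1 w) (of_ell1 w) ` G" if "t > 0" for t
      using v'(2,3)[OF that] D[of t "v' t"] G[of "v t" "v' t"] u[of t] that by simp
    ultimately show ?L by (intro exI[of _ "\<lambda>t. of_ell1 w (v' t)"]) blast
  qed
  then show ?thesis
    using continuous_map_top_w[of "{0..}" u v] u by (simp add: classical_solution_def)
qed

end

section \<open>Matrix operators\<close>

text \<open>Row 0 is forced to 0 to meet the normalisation of \<open>l1w\<close>. Column 0 is kept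
  in the series; it contributes nothing since the sequences in use vanish at 0.\<close>

definition mat :: "(nat \<Rightarrow> nat \<Rightarrow> real) \<Rightarrow> (nat \<Rightarrow> real) \<Rightarrow> nat \<Rightarrow> real" where
  "mat M f n = (if n = 0 then 0 else (\<Sum>j. M n j * f j))"

definition finseq :: "nat \<Rightarrow> (nat \<Rightarrow> real) set" where
  "finseq N = {f. f 0 = 0 \<and> (\<forall>n>N. f n = 0)}"

definition trunc :: "nat \<Rightarrow> (nat \<Rightarrow> real) \<Rightarrow> nat \<Rightarrow> real" where
  "trunc N f n = (if n \<le> N then f n else 0)"

lemma finseq_suminf:
  assumes "f \<in> finseq N"
  shows "(\<Sum>n. g n * f n) = (\<Sum>n=1..N. g n * f n)"
proof (rule suminf_finite)
  show "g n * f n = 0" if "n \<notin> {1..N}" for n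
    using assms that by (cases "n = 0") (auto simp: finseq_def)
qed simp

lemma mat_finseq: "f \<in> finseq N \<Longrightarrow> n \<ge> 1 \<Longrightarrow> mat M f n = (\<Sum>j=1..N. M n j * f j)"
  by (simp add: mat_def finseq_suminf)

lemma finseq_mono: "M \<le> N \<Longrightarrow> finseq M \<subseteq> finseq N"
  by (auto simp: finseq_def)

lemma trunc_finseq: "f 0 = 0 \<Longrightarrow> trunc N f \<in> finseq N"
  by (simp add: trunc_def finseq_def)

context weight
begin

lemma weight_nonneg: "n \<ge> 1 \<Longrightarrow> 0 \<le> w n"
  using weight_pos less_imp_le by blast

lemma weighted_abs_nonneg: "f 0 = 0 \<Longrightarrow> 0 \<le> w n * \<bar>f n\<bar>"
  by (cases "n = 0") (auto simp: weight_nonneg)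

lemma finseq_l1w: "f \<in> finseq N \<Longrightarrow> f \<in> l1w w"
  unfolding l1w_def finseq_def mem_Collect_eq
  by (intro conjI summable_finite[of "{..N}"]) simp_all

lemma to_ell1_add:
  "f \<in> l1w w \<Longrightarrow> g \<in> l1w w \<Longrightarrow> to_ell1 w (\<lambda>n. f n + g n) = to_ell1 w f + to_ell1 w g"
  by (auto elim!: l1w_cases simp flip: of_ell1_add)

lemma to_ell1_diff:
  "f \<in> l1w w \<Longrightarrow> g \<in> l1w w \<Longrightarrow> to_ell1 w (\<lambda>n. f n - g n) = to_ell1 w f - to_ell1 w g"
  by (auto elim!: l1w_cases simp flip: of_ell1_diff)

lemma to_ell1_scale: "f \<in> l1w w \<Longrightarrow> to_ell1 w (\<lambda>n. c * f n) = c *\<^sub>R to_ell1 w f"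
  by (auto elim!: l1w_cases simp flip: of_ell1_scaleR)

lemma trunc_tendsto:
  assumes f: "f \<in> l1w w"
  shows "(\<lambda>N. to_ell1 w (trunc N f)) \<longlonglongrightarrow> to_ell1 w f"
proof (rule LIM_zero_cancel, rule Lim_null_comparison)
  have s: "summable (\<lambda>n. w n * \<bar>f n\<bar>)" using f by (simp add: l1w_def)
  have t: "trunc N f \<in> l1w w" for N
    using f finseq_l1w[OF trunc_finseq] by (simp add: l1w_def)
  have "norm (to_ell1 w (trunc N f) - to_ell1 w f) = (\<Sum>n. w (n + Suc N) * \<bar>f (n + Suc N)\<bar>)" for N
  proof -
    have l: "(\<lambda>n. trunc N f n - f n) \<in> l1w w"
      using l1w_diff[OF weight_pos t f] .
    then have "summable (\<lambda>n. w n * \<bar>trunc N f n - f n\<bar>)" by (simp add: l1w_def)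
    from suminf_split_initial_segment[OF this, of "Suc N"]
    have "norm_w w (\<lambda>n. trunc N f n - f n) = (\<Sum>n. w (n + Suc N) * \<bar>f (n + Suc N)\<bar>)"
      by (simp add: norm_w_def trunc_def)
    then show ?thesis using norm_to_ell1[OF l] by (simp add: to_ell1_diff t f)
  qed
  then show "\<forall>\<^sub>F N in sequentially. norm (to_ell1 w (trunc N f) - to_ell1 w f)
      \<le> (\<Sum>n. w (n + Suc N) * \<bar>f (n + Suc N)\<bar>)" by simp
  have "(\<lambda>N. \<Sum>n. w (n + N) * \<bar>f (n + N)\<bar>) \<longlonglongrightarrow> 0"
    using suminf_exist_split2[OF s] by simp
  then show "(\<lambda>N. \<Sum>n. w (n + Suc N) * \<bar>f (n + Suc N)\<bar>) \<longlonglongrightarrow> 0"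
    by (rule LIMSEQ_Suc)
qed

lemma finseq_dense: "closure (to_ell1 w ` (\<Union>N. finseq N)) = UNIV"
proof -
  have "x \<in> closure (to_ell1 w ` (\<Union>N. finseq N))" for x
    unfolding closure_sequential
  proof (intro exI conjI allI)
    show "(\<lambda>N. to_ell1 w (trunc N (of_ell1 w x))) \<longlonglongrightarrow> x"
      using trunc_tendsto[of "of_ell1 w x"] by simp
    show "to_ell1 w (trunc N (of_ell1 w x)) \<in> to_ell1 w ` (\<Union>N. finseq N)" for N
      using trunc_finseq[of "of_ell1 w x" N] by (auto simp: of_ell1_def Rep_ell1_0)
  qed
  then show ?thesis by blast
qed

text \<open>On \<open>finseq N\<close> the norm is a finite weighted sum, so convergence of the
  coordinates is convergence in norm. This is how statements about the differential equations become
  statements in \<open>ell1\<close>.\<close>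

lemma tendsto_to_ell1_finseq:
  assumes F: "\<forall>\<^sub>F h in F. f h \<in> finseq N" and l: "l \<in> finseq N"
    and lim: "\<And>n. ((\<lambda>h. f h n) \<longlongrightarrow> l n) F"
  shows "((\<lambda>h. to_ell1 w (f h)) \<longlongrightarrow> to_ell1 w l) F"
proof (rule LIM_zero_cancel, rule Lim_null_comparison)
  show "\<forall>\<^sub>F h in F. norm (to_ell1 w (f h) - to_ell1 w l) \<le> (\<Sum>n\<le>N. w n * \<bar>f h n - l n\<bar>)"
    using F
  proof eventually_elim
    case (elim h)
    have "norm (to_ell1 w (f h) - to_ell1 w l) = norm_w w (\<lambda>n. f h n - l n)"
      using elim l by (simp add: norm_to_ell1 finseq_l1w l1w_diff[OF weight_pos] flip: to_ell1_diff)
    also have "\<dots> = (\<Sum>n\<le>N. w n * \<bar>f h n - l n\<bar>)"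
      unfolding norm_w_def using elim l by (intro suminf_finite) (auto simp: finseq_def)
    finally show ?case by simp
  qed
  have "((\<lambda>h. \<Sum>n\<le>N. w n * \<bar>f h n - l n\<bar>) \<longlongrightarrow> (\<Sum>n\<le>N. w n * \<bar>l n - l n\<bar>)) F"
    by (intro tendsto_intros lim)
  then show "((\<lambda>h. \<Sum>n\<le>N. w n * \<bar>f h n - l n\<bar>) \<longlongrightarrow> 0) F" by simp
qed

section \<open>Substochastic matrices as positive contractions\<close>

text \<open>The column condition says that the image of the \<open>j\<close>-th unit sequence has
  norm at most \<open>w j\<close>; it is stated through partial sums so that convergence is not a
  separate requirement. Both the solution matrix and the gain matrix are of this kind.\<close>

definition substoch_mat :: "(nat \<Rightarrow> nat \<Rightarrow> real) \<Rightarrow> bool" where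
  "substoch_mat M \<longleftrightarrow> (\<forall>n\<ge>1. \<forall>j\<ge>1. 0 \<le> M n j) \<and>
    (\<forall>N. \<forall>j\<ge>1. (\<Sum>n=1..N. w n * M n j) \<le> w j)"

context
  fixes M assumes M: "substoch_mat M"
begin

lemma substoch_mat_le:
  assumes "f \<in> l1w w"
  shows "(\<Sum>n=1..N. w n * (M n j * \<bar>f j\<bar>)) \<le> w j * \<bar>f j\<bar>"
proof (cases "j = 0")
  case False
  then have "(\<Sum>n=1..N. w n * M n j) * \<bar>f j\<bar> \<le> w j * \<bar>f j\<bar>"
    using M by (intro mult_right_mono) (auto simp: substoch_mat_def)
  then show ?thesis by (simp add: sum_distrib_right mult.assoc)
qed (use assms in \<open>simp add: l1w_def\<close>)

lemma M_nonneg: "n \<ge> 1 \<Longrightarrow> f \<in> l1w w \<Longrightarrow> 0 \<le> M n j * \<bar>f j\<bar>"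
  using M by (cases "j = 0") (auto simp: substoch_mat_def l1w_def)

lemma M_abs: "n \<ge> 1 \<Longrightarrow> f \<in> l1w w \<Longrightarrow> \<bar>M n j * f j\<bar> = M n j * \<bar>f j\<bar>"
  using M by (cases "j = 0") (auto simp: substoch_mat_def l1w_def abs_mult)

text \<open>A single entry is dominated by its column: \<open>w n * M n j\<close> is at most
  \<open>w j\<close>, so row \<open>n\<close> is summable against \<open>f\<close> with the majorant
  \<open>w j * \<bar>f j\<bar> / w n\<close>.\<close>

lemma substoch_mat_summable_abs:
  assumes f: "f \<in> l1w w" and n: "n \<ge> 1"
  shows "summable (\<lambda>j. M n j * \<bar>f j\<bar>)"
proof (rule summable_comparison_test')
  have wn: "w n > 0" using weight_pos n by simp
  show "summable (\<lambda>j. w j * \<bar>f j\<bar> / w n)"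
    using f by (intro summable_divide) (simp add: l1w_def)
  fix j
  have "w n * (M n j * \<bar>f j\<bar>) \<le> (\<Sum>k=1..n. w k * (M k j * \<bar>f j\<bar>))"
    using n
    by (intro member_le_sum[of n "{1..n}" "\<lambda>k. w k * (M k j * \<bar>f j\<bar>)"])
      (simp_all add: M_nonneg[OF _ f] weight_nonneg)
  also have "\<dots> \<le> w j * \<bar>f j\<bar>" by (rule substoch_mat_le[OF f])
  finally show "norm (M n j * \<bar>f j\<bar>) \<le> w j * \<bar>f j\<bar> / w n"
    using wn M_nonneg[OF n f, of j] by (simp add: pos_le_divide_eq mult.commute)
qed

lemma substoch_mat_summable:
  assumes f: "f \<in> l1w w" and n: "n \<ge> 1"
  shows "summable (\<lambda>j. M n j * f j)"
proof (rule summable_rabs_cancel)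
  show "summable (\<lambda>j. \<bar>M n j * f j\<bar>)"
    unfolding M_abs[OF n f] by (rule substoch_mat_summable_abs[OF f n])
qed

text \<open>With finitely many rows only a finite sum has to be exchanged with a series; the column
  bound then applies term by term. The uniform bound yields summability over all rows as well as the
  norm estimate.\<close>

lemma substoch_mat_partial_sum_le:
  assumes f: "f \<in> l1w w"
  shows "(\<Sum>n<N. w n * \<bar>mat M f n\<bar>) \<le> norm_w w f"
proof -
  have "(\<Sum>n<N. w n * \<bar>mat M f n\<bar>) \<le> (\<Sum>n\<le>N. w n * \<bar>mat M f n\<bar>)"
    by (intro sum_mono2 weighted_abs_nonneg) (auto simp: mat_def)
  also have "\<dots> = (\<Sum>n=1..N. w n * \<bar>mat M f n\<bar>)"
    by (rule sum.mono_neutral_right) (auto simp: mat_def not_less_eq_eq)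
  also have "\<dots> \<le> (\<Sum>n=1..N. \<Sum>j. w n * (M n j * \<bar>f j\<bar>))"
  proof (rule sum_mono)
    fix n assume "n \<in> {1..N}"
    then have n: "n \<ge> 1" by simp
    have "summable (\<lambda>j. \<bar>M n j * f j\<bar>)"
      unfolding M_abs[OF n f] by (rule substoch_mat_summable_abs[OF f n])
    from summable_rabs[OF this] have "\<bar>mat M f n\<bar> \<le> (\<Sum>j. M n j * \<bar>f j\<bar>)"
      unfolding M_abs[OF n f] using n by (simp add: mat_def)
    then have "w n * \<bar>mat M f n\<bar> \<le> w n * (\<Sum>j. M n j * \<bar>f j\<bar>)"
      using n by (intro mult_left_mono) (simp_all add: weight_nonneg)
    then show "w n * \<bar>mat M f n\<bar> \<le> (\<Sum>j. w n * (M n j * \<bar>f j\<bar>))"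
      using substoch_mat_summable_abs[OF f n] by (simp add: suminf_mult)
  qed
  also have "\<dots> = (\<Sum>j. \<Sum>n=1..N. w n * (M n j * \<bar>f j\<bar>))"
    by (intro suminf_sum[symmetric] summable_mult substoch_mat_summable_abs f) simp
  also have "\<dots> \<le> norm_w w f"
    unfolding norm_w_def
  proof (rule suminf_le)
    show "summable (\<lambda>j. \<Sum>n=1..N. w n * (M n j * \<bar>f j\<bar>))"
      by (intro summable_sum summable_mult substoch_mat_summable_abs f) simp
    show "summable (\<lambda>n. w n * \<bar>f n\<bar>)" using f by (simp add: l1w_def)
  qed (rule substoch_mat_le[OF f])
  finally show ?thesis .
qed

lemma substoch_mat_bounded:
  assumes f: "f \<in> l1w w"
  shows "mat M f \<in> l1w w" "norm_w w (mat M f) \<le> norm_w w f"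
proof -
  have nn: "0 \<le> w n * \<bar>mat M f n\<bar>" for n
    by (rule weighted_abs_nonneg) (simp add: mat_def)
  have "summable (\<lambda>n. w n * \<bar>mat M f n\<bar>)"
    by (rule summableI_nonneg_bounded[OF nn substoch_mat_partial_sum_le[OF f]])
  then show "mat M f \<in> l1w w" "norm_w w (mat M f) \<le> norm_w w f"
    using substoch_mat_partial_sum_le[OF f]
    by (auto simp: l1w_def mat_def[of _ _ 0] norm_w_def intro!: suminf_le_const)
qed

lemma substoch_mat_add:
  assumes "f \<in> l1w w" "g \<in> l1w w"
  shows "mat M (\<lambda>n. f n + g n) = (\<lambda>n. mat M f n + mat M g n)"
proof
  show "mat M (\<lambda>n. f n + g n) n = mat M f n + mat M g n" for n
    using suminf_add[OF substoch_mat_summable substoch_mat_summable, OF assms(1) _ assms(2), of n n]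
    by (auto simp: mat_def distrib_left)
qed

lemma substoch_mat_scale:
  assumes "f \<in> l1w w"
  shows "mat M (\<lambda>n. c * f n) = (\<lambda>n. c * mat M f n)"
proof
  show "mat M (\<lambda>n. c * f n) n = c * mat M f n" for n
    using suminf_mult[OF substoch_mat_summable, OF assms, of n c]
    by (auto simp: mat_def algebra_simps)
qed

lemma bounded_linear_substoch_mat: "bounded_linear (\<lambda>x. to_ell1 w (mat M (of_ell1 w x)))"
proof (rule bounded_linear_intro[of _ 1])
  show "to_ell1 w (mat M (of_ell1 w (x + y))) = to_ell1 w (mat M (of_ell1 w x)) + to_ell1 w (mat M (of_ell1 w y))"
    for x y
    by (subst to_ell1_add[symmetric])
      (simp_all add: substoch_mat_bounded of_ell1_add substoch_mat_add)
  show "to_ell1 w (mat M (of_ell1 w (c *\<^sub>R x))) = c *\<^sub>R to_ell1 w (mat M (of_ell1 w x))" for c x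
    by (subst to_ell1_scale[symmetric])
      (simp_all add: substoch_mat_bounded of_ell1_scaleR substoch_mat_scale)
  show "norm (to_ell1 w (mat M (of_ell1 w x))) \<le> norm x * 1" for x
    using substoch_mat_bounded(2)[of "of_ell1 w x"] by (simp add: norm_to_ell1 substoch_mat_bounded)
qed

end

end

section \<open>The fragmentation semigroup\<close>

text \<open>The expression solves \<open>z' = g - c * z\<close> with \<open>z 0 = y\<close>; the
  derivative is taken within \<open>{0..}\<close> so that time 0 is covered.\<close>

lemma variation_of_constants:
  fixes g :: "real \<Rightarrow> real"
  assumes g: "continuous_on {0..} g" and t: "t \<ge> 0"
  shows "((\<lambda>t. exp (- c * t) * (y + integral {0..t} (\<lambda>s. exp (c * s) * g s))) has_real_derivative
    g t - c * (exp (- c * t) * (y + integral {0..t} (\<lambda>s. exp (c * s) * g s)))) (at t within {0..})"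
proof -
  have "((\<lambda>t. integral {0..t} (\<lambda>s. exp (c * s) * g s)) has_real_derivative exp (c * t) * g t)
      (at t within {0..t + 1})"
    using t by (intro integral_has_real_derivative continuous_intros continuous_on_subset[OF g]) auto
  \<comment> \<open>The end \<open>t + 1\<close> lies strictly above \<open>t\<close>, hence does
    not influence the filter; with end \<open>t\<close> the right derivative would be lost.\<close>
  moreover have "at t within {0..t + 1} = at t within {0..}"
    by (rule at_within_nhd[of t "{..<t + 1}"]) auto
  ultimately have "((\<lambda>t. integral {0..t} (\<lambda>s. exp (c * s) * g s)) has_real_derivative exp (c * t) * g t)
      (at t within {0..})" by simp
  moreover have "exp (- (c * t)) * (exp (c * t) * g t) = g t"
    by (simp add: mult.assoc[symmetric] exp_add[symmetric])
  ultimately show ?thesis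
    by (auto intro!: derivative_eq_intros simp: algebra_simps)
qed

locale fragmentation = weight +
  fixes a :: "nat \<Rightarrow> real" and b :: "nat \<Rightarrow> nat \<Rightarrow> real"
  assumes a_nonneg: "n \<ge> 1 \<Longrightarrow> 0 \<le> a n"
    and b_nonneg: "n \<ge> 1 \<Longrightarrow> j \<ge> 1 \<Longrightarrow> 0 \<le> b n j"
    and b_weight: "j \<ge> 2 \<Longrightarrow> (\<Sum>n=1..j-1. w n * b n j) \<le> w j"
begin

text \<open>\<open>B\<close> factors as this strictly upper triangular matrix after multiplication
  by \<open>a\<close>. Since the matrix is substochastic, \<open>B f\<close> is controlled by the
  norm of \<open>a f\<close>, that is, by \<open>A f\<close>.\<close>

definition gain :: "nat \<Rightarrow> nat \<Rightarrow> real" where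
  "gain n j = (if n < j then b n j else 0)"

definition frag :: "(nat \<Rightarrow> real) \<Rightarrow> nat \<Rightarrow> real" where
  "frag f n = mat gain (\<lambda>j. a j * f j) n - a n * f n"

lemma substoch_gain: "substoch_mat gain"
  unfolding substoch_mat_def
proof (intro conjI allI impI)
  show "0 \<le> gain n j" if "n \<ge> 1" "j \<ge> 1" for n j
    using b_nonneg that by (simp add: gain_def)
  show "(\<Sum>n=1..N. w n * gain n j) \<le> w j" if j: "j \<ge> 1" for N j
  proof -
    have "(\<Sum>n=1..N. w n * gain n j) = (\<Sum>n\<in>{1..N} \<inter> {..<j}. w n * b n j)"
      by (rule sum.mono_neutral_cong_right) (auto simp: gain_def)
    also have "\<dots> \<le> (\<Sum>n=1..j-1. w n * b n j)"
      using j by (intro sum_mono2) (auto simp: weight_nonneg b_nonneg)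
    also have "\<dots> \<le> w j"
      using b_weight[of j] weight_nonneg[of j] j by (cases "j = 1") auto
    finally show ?thesis .
  qed
qed

lemma a_finseq: "f \<in> finseq N \<Longrightarrow> (\<lambda>j. a j * f j) \<in> finseq N"
  by (simp add: finseq_def)

lemma frag_finseq_eq:
  assumes f: "f \<in> finseq N" and n: "n \<ge> 1"
  shows "frag f n = (\<Sum>k\<in>{n<..N}. b n k * (a k * f k)) - a n * f n"
proof -
  have "mat gain (\<lambda>j. a j * f j) n = (\<Sum>k=1..N. gain n k * (a k * f k))"
    by (rule mat_finseq[OF a_finseq[OF f] n])
  also have "\<dots> = (\<Sum>k\<in>{n<..N}. b n k * (a k * f k))"
    by (rule sum.mono_neutral_cong_right) (auto simp: gain_def)
  finally show ?thesis by (simp add: frag_def)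
qed

lemma frag_0: "f 0 = 0 \<Longrightarrow> frag f 0 = 0"
  by (simp add: frag_def mat_def)

lemma frag_finseq: "f \<in> finseq N \<Longrightarrow> frag f \<in> finseq N"
proof -
  assume f: "f \<in> finseq N"
  have "frag f n = 0" if "n > N" for n
    using frag_finseq_eq[OF f, of n] f that by (simp add: finseq_def)
  then show ?thesis using f by (simp add: finseq_def frag_0)
qed

lemma frag_add:
  assumes f: "f \<in> finseq N" and g: "g \<in> finseq N"
  shows "frag (\<lambda>n. f n + g n) n = frag f n + frag g n"
proof (cases "n = 0")
  case False
  have "(\<lambda>n. f n + g n) \<in> finseq N" using f g by (simp add: finseq_def)
  with False show ?thesis
    by (simp add: frag_finseq_eq[of _ N] f g sum.distrib algebra_simps)
qed (use f g in \<open>simp add: frag_0 finseq_def\<close>)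

lemma frag_diff:
  assumes f: "f \<in> finseq N" and g: "g \<in> finseq N"
  shows "frag (\<lambda>n. f n - g n) n = frag f n - frag g n"
proof (cases "n = 0")
  case False
  have "(\<lambda>n. f n - g n) \<in> finseq N" using f g by (simp add: finseq_def)
  with False show ?thesis
    by (simp add: frag_finseq_eq[of _ N] f g sum_subtractf algebra_simps)
qed (use f g in \<open>simp add: frag_0 finseq_def\<close>)

text \<open>Exchanging the sums over \<open>n < k\<close> groups the balance by the breaking size
  \<open>k\<close>: its rate times the weight of the fragments minus the weight of the parent. With
  \<open>v = w\<close> this yields decay of the norm, with \<open>v = real\<close> conservation of
  mass.\<close>

lemma weighted_sum_frag:
  assumes f: "f \<in> finseq N"
  shows "(\<Sum>n=1..N. v n * frag f n) = (\<Sum>k=1..N. a k * f k * ((\<Sum>n=1..k-1. v n * b n k) - v k))"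
proof -
  have "(\<Sum>n=1..N. v n * frag f n)
      = (\<Sum>n=1..N. \<Sum>k\<in>{k\<in>{1..N}. n < k}. v n * (b n k * (a k * f k))) - (\<Sum>n=1..N. v n * (a n * f n))"
    unfolding sum_subtractf[symmetric]
  proof (rule sum.cong)
    fix n assume n: "n \<in> {1..N}"
    then have "{k \<in> {1..N}. n < k} = {n<..N}" by auto
    with n show "v n * frag f n = (\<Sum>k\<in>{k\<in>{1..N}. n < k}. v n * (b n k * (a k * f k))) - v n * (a n * f n)"
      by (simp add: frag_finseq_eq[OF f] right_diff_distrib sum_distrib_left)
  qed simp
  also have "(\<Sum>n=1..N. \<Sum>k\<in>{k\<in>{1..N}. n < k}. v n * (b n k * (a k * f k)))
      = (\<Sum>k=1..N. \<Sum>n\<in>{n\<in>{1..N}. n < k}. v n * (b n k * (a k * f k)))"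
    by (rule sum.swap_restrict) auto
  also have "\<dots> = (\<Sum>k=1..N. a k * f k * (\<Sum>n=1..k-1. v n * b n k))"
  proof (rule sum.cong)
    fix k assume k: "k \<in> {1..N}"
    then have "{n\<in>{1..N}. n < k} = {1..k-1}" by auto
    then show "(\<Sum>n\<in>{n\<in>{1..N}. n < k}. v n * (b n k * (a k * f k))) = a k * f k * (\<Sum>n=1..k-1. v n * b n k)"
      by (simp add: sum_distrib_left algebra_simps)
  qed simp
  finally show ?thesis
    by (simp add: sum_subtractf[symmetric] right_diff_distrib algebra_simps)
qed

section \<open>The triangular system of differential equations on finite sequences\<close>

definition solves :: "nat \<Rightarrow> (real \<Rightarrow> nat \<Rightarrow> real) \<Rightarrow> bool" where
  "solves N u \<longleftrightarrow> (\<forall>t\<ge>0. u t \<in> finseq N \<and>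
    (\<forall>n\<ge>1. ((\<lambda>t. u t n) has_real_derivative frag (u t) n) (at t within {0..})))"

text \<open>The equation for size \<open>n\<close> involves only sizes from \<open>n\<close>
  upwards. Descending from \<open>N\<close>, once all larger components of the difference vanish,
  \<open>exp (a n * t) * d t n\<close> has derivative 0 and keeps its initial value 0.\<close>

lemma solves_unique:
  assumes u: "solves N u" and v: "solves N v" and init: "u 0 = v 0" and t: "t \<ge> 0"
  shows "u t = v t"
proof -
  define d where "d t = (\<lambda>n. u t n - v t n)" for t
  have d_fin: "d t \<in> finseq N" if "t \<ge> 0" for t
    using u v that by (simp add: solves_def d_def finseq_def)
  have d_ode: "((\<lambda>t. d t n) has_real_derivative frag (d t) n) (at t within {0..})"
    if "t \<ge> 0" "n \<ge> 1" for t n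
    using u v that unfolding d_def
    by (subst frag_diff[of _ N]) (auto simp: solves_def intro!: derivative_intros)
  have "\<forall>t\<ge>0. d t n = 0" for n
  proof (induction "N - n" arbitrary: n rule: less_induct)
    case less
    show ?case
    proof (cases "1 \<le> n \<and> n \<le> N")
      case False
      then have "n = 0 \<or> N < n" by auto
      then show ?thesis using d_fin by (auto simp: finseq_def)
    next
      case True
      have "frag (d t) n = - a n * d t n" if "t \<ge> 0" for t
      proof -
        have "(\<Sum>k\<in>{n<..N}. b n k * (a k * d t k)) = 0"
          using less[of k for k] True that by (intro sum.neutral) auto
        then show ?thesis using True that by (simp add: frag_finseq_eq[OF d_fin])
      qed
      then have ode: "((\<lambda>t. exp (a n * t) * d t n) has_real_derivative 0) (at t within {0..})" if "t \<ge> 0" for t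
        using d_ode[OF that, of n] True that
        by (auto intro!: derivative_eq_intros simp: algebra_simps)
      have "\<exists>c. \<forall>t\<in>{0..}. exp (a n * t) * d t n = c"
        by (rule has_field_derivative_zero_constant) (auto intro: ode)
      then obtain c where c: "\<And>t. t \<ge> 0 \<Longrightarrow> exp (a n * t) * d t n = c" by auto
      from c[of 0] have "c = 0" by (simp add: d_def init)
      then show ?thesis using c by simp
    qed
  qed
  then show ?thesis using t by (auto simp: d_def fun_eq_iff)
qed

text \<open>
  \<open>col j n t\<close> is the amount of size \<open>n\<close> at time \<open>t\<close> evolved from the \<open>j\<close>-th unit sequence, given by
  variation of constants in terms of the larger sizes.
\<close>

function col :: "nat \<Rightarrow> nat \<Rightarrow> real \<Rightarrow> real" where
  "col j n t = (if n = 0 \<or> j < n then 0 else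
    exp (- a n * t) * ((if n = j then 1 else 0) +
      integral {0..t} (\<lambda>s. exp (a n * s) * (\<Sum>k\<in>{n<..j}. b n k * (a k * col j k s)))))"
  by pat_completeness auto
termination by (relation "Wellfounded.measure (\<lambda>(j, n, t). j - n)") auto

declare col.simps [simp del]

lemma col_outside: "n = 0 \<or> j < n \<Longrightarrow> col j n t = 0"
  by (subst col.simps) simp

lemma col_finseq: "(\<lambda>n. col j n t) \<in> finseq j"
  by (simp add: finseq_def col_outside)

lemma col_0: "j \<ge> 1 \<Longrightarrow> col j n 0 = (if n = j then 1 else 0)"
  by (subst col.simps) simp

text \<open>Descending in \<open>n\<close>, differentiability of the larger sizes makes the
  inhomogeneity continuous, as variation of constants requires.\<close>

lemma col_ode:
  assumes "n \<ge> 1" "t \<ge> 0"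
  shows "(col j n has_real_derivative frag (\<lambda>n. col j n t) n) (at t within {0..})"
  using assms
proof (induction "j - n" arbitrary: n t rule: less_induct)
  case less
  show ?case
  proof (cases "n \<le> j")
    case True
    have "continuous_on {0..} (col j k)" if "k \<in> {n<..j}" for k
      unfolding continuous_on_eq_continuous_within
      by (intro ballI DERIV_continuous[OF less.hyps]) (use that True in auto)
    then have cont: "continuous_on {0..} (\<lambda>s. \<Sum>k\<in>{n<..j}. b n k * (a k * col j k s))"
      by (intro continuous_intros) auto
    have col_eq: "col j n = (\<lambda>t. exp (- a n * t) * ((if n = j then 1 else 0) +
        integral {0..t} (\<lambda>s. exp (a n * s) * (\<Sum>k\<in>{n<..j}. b n k * (a k * col j k s)))))"
      by (rule ext, subst col.simps) (use True less.prems in simp)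
    from variation_of_constants[OF cont \<open>t \<ge> 0\<close>, of "a n" "if n = j then 1 else 0", folded col_eq]
    show ?thesis
      using fun_cong[OF col_eq, of t] by (simp add: frag_finseq_eq[OF col_finseq less.prems(1)])
  next
    case False
    then have "col j n = (\<lambda>_. 0)" by (intro ext col_outside) auto
    moreover have "frag (\<lambda>n. col j n t) n = 0"
      using frag_finseq[OF col_finseq[of j t]] False by (simp add: finseq_def)
    ultimately show ?thesis by simp
  qed
qed

lemma col_continuous: "n \<ge> 1 \<Longrightarrow> continuous_on {0..} (col j n)"
  unfolding continuous_on_eq_continuous_within using col_ode by (auto intro!: DERIV_continuous)

text \<open>The loss term sits in the exponential factors only, so every ingredient of the recursive
  formula is nonnegative.\<close>

lemma col_nonneg: "t \<ge> 0 \<Longrightarrow> 0 \<le> col j n t"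
proof (induction "j - n" arbitrary: n t rule: less_induct)
  case less
  show ?case
  proof (cases "n = 0 \<or> j < n")
    case False
    have "0 \<le> integral {0..t} (\<lambda>s. exp (a n * s) * (\<Sum>k\<in>{n<..j}. b n k * (a k * col j k s)))"
    proof (rule integral_nonneg)
      show "(\<lambda>s. exp (a n * s) * (\<Sum>k\<in>{n<..j}. b n k * (a k * col j k s))) integrable_on {0..t}"
        by (intro integrable_continuous_real continuous_intros continuous_on_subset[OF col_continuous]) auto
      show "0 \<le> exp (a n * s) * (\<Sum>k\<in>{n<..j}. b n k * (a k * col j k s))" if "s \<in> {0..t}" for s
        using that False less by (intro mult_nonneg_nonneg sum_nonneg) (auto simp: a_nonneg b_nonneg)
    qed
    then show ?thesis using False by (subst col.simps) auto
  qed (simp add: col_outside)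
qed

lemma weighted_sum_solution_derivative:
  assumes "solves N u" "t \<ge> 0"
  shows "((\<lambda>t. \<Sum>n=1..N. v n * u t n) has_real_derivative
    (\<Sum>k=1..N. a k * u t k * ((\<Sum>n=1..k-1. v n * b n k) - v k))) (at t within {0..})"
proof -
  have "((\<lambda>t. \<Sum>n=1..N. v n * u t n) has_real_derivative (\<Sum>n=1..N. v n * frag (u t) n)) (at t within {0..})"
    using assms by (intro DERIV_sum DERIV_cmult) (auto simp: solves_def)
  moreover have "u t \<in> finseq N" using assms by (simp add: solves_def)
  ultimately show ?thesis by (simp only: weighted_sum_frag)
qed

lemma col_solves: "solves j (\<lambda>t n. col j n t)"
  by (simp add: solves_def col_finseq col_ode)

text \<open>The balance \<open>weighted_sum_frag\<close> with \<open>v = w\<close> has only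
  nonpositive terms: fragments weigh at most as much as their parent, by \<open>b_weight\<close>,
  and for size 1 the sum of fragments is empty.\<close>

lemma col_weight:
  assumes j: "j \<ge> 1" and t: "t \<ge> 0"
  shows "(\<Sum>n=1..j. w n * col j n t) \<le> w j"
proof -
  let ?\<phi> = "\<lambda>t. \<Sum>n=1..j. w n * col j n t"
  let ?d = "\<lambda>t. \<Sum>k=1..j. a k * col j k t * ((\<Sum>n=1..k-1. w n * b n k) - w k)"
  note D = weighted_sum_solution_derivative[OF col_solves, of _ w j]
  have "?\<phi> t \<le> ?\<phi> 0"
  proof (rule DERIV_nonpos_imp_decreasing_open[OF t])
    fix s assume s: "0 < s" "s < t"
    have "(?\<phi> has_real_derivative ?d s) (at s within {0<..})"
      by (rule DERIV_subset[OF D]) (use s in auto)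
    moreover have "at s within {0<..} = at s"
      using s by (intro at_within_open) auto
    ultimately have "(?\<phi> has_real_derivative ?d s) (at s)" by (simp only:)
    moreover have "?d s \<le> 0"
    proof (rule sum_nonpos)
      fix k assume k: "k \<in> {1..j}"
      have "(\<Sum>n=1..k-1. w n * b n k) \<le> w k"
        using b_weight[of k] weight_nonneg[of k] k by (cases "k = 1") auto
      then show "a k * col j k s * ((\<Sum>n=1..k-1. w n * b n k) - w k) \<le> 0"
        using k s by (intro mult_nonneg_nonpos mult_nonneg_nonneg) (auto simp: a_nonneg col_nonneg)
    qed
    ultimately show "\<exists>y. (?\<phi> has_real_derivative y) (at s) \<and> y \<le> 0" by blast
  next
    show "continuous_on {0..t} ?\<phi>"
      by (intro continuous_intros continuous_on_subset[OF col_continuous]) auto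
  qed
  also have "?\<phi> 0 = (\<Sum>n=1..j. if n = j then w n else 0)"
    using j by (intro sum.cong) (auto simp: col_0)
  also have "\<dots> = w j" using j by simp
  finally show ?thesis .
qed

lemma substoch_col:
  assumes t: "t \<ge> 0"
  shows "substoch_mat (\<lambda>n j. col j n t)"
  unfolding substoch_mat_def
proof (intro conjI allI impI)
  show "(\<Sum>n=1..N. w n * col j n t) \<le> w j" if j: "j \<ge> 1" for N j
  proof -
    have "(\<Sum>n=1..N. w n * col j n t) = (\<Sum>n\<in>{1..N} \<inter> {..j}. w n * col j n t)"
      by (rule sum.mono_neutral_right) (auto simp: col_outside)
    also have "\<dots> \<le> (\<Sum>n=1..j. w n * col j n t)"
      using t by (intro sum_mono2) (auto simp: weight_nonneg col_nonneg)
    also have "\<dots> \<le> w j" by (rule col_weight[OF j t])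
    finally show ?thesis .
  qed
qed (use t in \<open>simp add: col_nonneg\<close>)

section \<open>The solution matrix as a semigroup on the whole space\<close>

definition flow :: "real \<Rightarrow> (nat \<Rightarrow> real) \<Rightarrow> nat \<Rightarrow> real" where
  "flow t f = mat (\<lambda>n j. col j n t) f"

lemma flow_solves:
  assumes f: "f \<in> finseq N"
  shows "solves N (\<lambda>t. flow t f)"
  unfolding solves_def
proof (intro allI impI conjI)
  have eq: "flow t f n = (\<Sum>j=1..N. col j n t * f j)" if "n \<ge> 1" for n t
    using f that by (simp add: flow_def mat_finseq)
  fix t :: real assume t: "t \<ge> 0"
  show fin: "flow t f \<in> finseq N"
    unfolding finseq_def
  proof (intro CollectI conjI allI impI)
    show "flow t f n = 0" if "n > N" for n
      using that eq[of n t] by (simp add: col_outside)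
  qed (simp add: flow_def mat_def)
  fix n :: nat assume n: "n \<ge> 1"
  have colN: "(\<lambda>n. col j n t) \<in> finseq N" if "j \<in> {1..N}" for j
    using col_finseq finseq_mono[of j N] that by auto
  have "((\<lambda>t. \<Sum>j=1..N. col j n t * f j) has_real_derivative
      (\<Sum>j=1..N. frag (\<lambda>n. col j n t) n * f j)) (at t within {0..})"
    using n t by (intro DERIV_sum DERIV_cmult_right col_ode)
  moreover have "(\<Sum>j=1..N. frag (\<lambda>n. col j n t) n * f j) = frag (flow t f) n"
  proof -
    have "(\<Sum>j=1..N. frag (\<lambda>n. col j n t) n * f j)
        = (\<Sum>j=1..N. \<Sum>k\<in>{n<..N}. b n k * (a k * (col j k t * f j))) - (\<Sum>j=1..N. a n * (col j n t * f j))"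
      unfolding sum_subtractf[symmetric]
      by (rule sum.cong)
        (simp_all only: frag_finseq_eq[OF colN n] left_diff_distrib sum_distrib_right mult.assoc)
    also have "(\<Sum>j=1..N. \<Sum>k\<in>{n<..N}. b n k * (a k * (col j k t * f j)))
        = (\<Sum>k\<in>{n<..N}. \<Sum>j=1..N. b n k * (a k * (col j k t * f j)))"
      by (rule sum.swap)
    also have "\<dots> = (\<Sum>k\<in>{n<..N}. b n k * (a k * flow t f k))"
      using n by (intro sum.cong) (auto simp: eq sum_distrib_left)
    also have "(\<Sum>j=1..N. a n * (col j n t * f j)) = a n * flow t f n"
      by (simp only: eq[OF n] sum_distrib_left)
    finally show ?thesis
      by (simp only: frag_finseq_eq[OF fin n])
  qed
  ultimately show "((\<lambda>t. flow t f n) has_real_derivative frag (flow t f) n) (at t within {0..})"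
    by (simp only: eq[OF n])
qed

lemma flow_finseq: "f \<in> finseq N \<Longrightarrow> t \<ge> 0 \<Longrightarrow> flow t f \<in> finseq N"
  using flow_solves by (simp add: solves_def)

lemma flow_0:
  assumes f: "f \<in> finseq N"
  shows "flow 0 f = f"
proof
  fix n
  show "flow 0 f n = f n"
  proof (cases "n = 0")
    case False
    then have "flow 0 f n = (\<Sum>j=1..N. col j n 0 * f j)"
      using f by (simp add: flow_def mat_finseq)
    also have "\<dots> = (\<Sum>j=1..N. if j = n then f j else 0)"
      by (intro sum.cong) (auto simp: col_0)
    also have "\<dots> = f n" using f False by (simp add: finseq_def)
    finally show ?thesis .
  qed (use f in \<open>simp add: flow_def mat_def finseq_def\<close>)
qed

text \<open>As functions of \<open>s\<close>, both sides solve the same system from the same initial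
  value \<open>flow t f\<close>.\<close>

lemma flow_add:
  assumes f: "f \<in> finseq N" and s: "s \<ge> 0" and t: "t \<ge> 0"
  shows "flow (s + t) f = flow s (flow t f)"
proof (rule solves_unique[of N "\<lambda>s. flow (s + t) f" "\<lambda>s. flow s (flow t f)"])
  have sol: "solves N (\<lambda>t. flow t f)" by (rule flow_solves[OF f])
  show "solves N (\<lambda>s. flow (s + t) f)"
    unfolding solves_def
  proof (intro allI impI conjI)
    fix r :: real assume r: "r \<ge> 0"
    show "flow (r + t) f \<in> finseq N" using f r t by (simp add: flow_finseq)
    fix n :: nat assume n: "n \<ge> 1"
    have "((\<lambda>t. flow t f n) has_real_derivative frag (flow (r + t) f) n) (at (r + t) within {0..})"
      using sol r t n by (simp add: solves_def)
    \<comment> \<open>The derivative is restricted to the image of \<open>{0..}\<close> under the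
      shift, the form in which the chain rule within sets applies.\<close>
    then have "((\<lambda>t. flow t f n) has_real_derivative frag (flow (r + t) f) n)
        (at (r + t) within (\<lambda>s. s + t) ` {0..})"
      by (rule DERIV_subset) (use t in auto)
    moreover have "((\<lambda>s. s + t) has_real_derivative 1) (at r within {0..})"
      by (auto intro!: derivative_eq_intros)
    ultimately have "((\<lambda>t. flow t f n) \<circ> (\<lambda>s. s + t) has_real_derivative frag (flow (r + t) f) n * 1)
        (at r within {0..})"
      by (rule DERIV_image_chain)
    then show "((\<lambda>s. flow (s + t) f n) has_real_derivative frag (flow (r + t) f) n) (at r within {0..})"
      by (simp add: o_def)
  qed
  show "solves N (\<lambda>s. flow s (flow t f))"
    by (rule flow_solves[OF flow_finseq[OF f t]])
  show "flow (0 + t) f = flow 0 (flow t f)"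
    using flow_0[OF flow_finseq[OF f t]] by simp
qed (rule s)

lemma flow_component_limits:
  assumes f: "f \<in> finseq N"
  shows "((\<lambda>h. (flow h f n - f n) / h) \<longlongrightarrow> frag f n) (at_right 0)"
    and "((\<lambda>h. flow h f n) \<longlongrightarrow> f n) (at_right 0)"
proof -
  have f0: "flow h f 0 = f 0" for h using f by (simp add: flow_def mat_def finseq_def)
  have D: "((\<lambda>t. flow t f n) has_real_derivative frag f n) (at 0 within {0..})"
  proof (cases "n = 0")
    case False
    then show ?thesis
      using flow_solves[OF f] flow_0[OF f] unfolding solves_def by (metis One_nat_def Suc_leI neq0_conv order_refl)
  qed (use f f0 in \<open>simp add: finseq_def frag_0\<close>)
  then show "((\<lambda>h. (flow h f n - f n) / h) \<longlongrightarrow> frag f n) (at_right 0)"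
    by (simp add: has_field_derivative_iff flow_0[OF f] at_within_Ici_at_right)
  show "((\<lambda>h. flow h f n) \<longlongrightarrow> f n) (at_right 0)"
    using DERIV_continuous[OF D] by (simp add: continuous_within flow_0[OF f] at_within_Ici_at_right)
qed

abbreviation "T \<equiv> ell1_family flow"

lemma T_to_ell1: "f \<in> l1w w \<Longrightarrow> T t (to_ell1 w f) = to_ell1 w (flow t f)"
  by (simp add: ell1_family_def)

text \<open>Boundedness and contractivity hold on all of \<open>ell1\<close> through the matrix
  estimates; the semigroup laws come from the differential equations, hence first for finite
  sequences.\<close>

sublocale T: contraction_sg T
proof (rule contraction_sg_dense[OF _ _ finseq_dense])
  show "bounded_linear (T t)" if "t \<ge> 0" for t
    using bounded_linear_substoch_mat[OF substoch_col[OF that]]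
    by (simp add: ell1_family_def[abs_def] flow_def)
  show "norm (T t x) \<le> norm x" if "t \<ge> 0" for t x
    using substoch_mat_bounded[OF substoch_col[OF that], of "of_ell1 w x"]
    by (simp add: ell1_family_def flow_def norm_to_ell1)
  fix x assume "x \<in> to_ell1 w ` (\<Union>N. finseq N)"
  then obtain f N where x: "x = to_ell1 w f" and f: "f \<in> finseq N" by auto
  show "T 0 x = x"
    by (simp add: x T_to_ell1 finseq_l1w[OF f] flow_0[OF f])
  show "T (s + t) x = T s (T t x)" if "s \<ge> 0" "t \<ge> 0" for s t
    using that
    by (simp add: x T_to_ell1 finseq_l1w[OF f] finseq_l1w[OF flow_finseq[OF f]] flow_add[OF f])
  have "((\<lambda>t. to_ell1 w (flow t f)) \<longlongrightarrow> to_ell1 w f) (at_right 0)"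
    using eventually_at_right_less[of 0]
    by (intro tendsto_to_ell1_finseq[OF _ f] flow_component_limits(2)[OF f])
      (auto elim!: eventually_mono simp: flow_finseq[OF f])
  then show "((\<lambda>t. T t x) \<longlongrightarrow> x) (at_right 0)"
    by (simp add: x T_to_ell1 finseq_l1w[OF f])
qed

section \<open>A core for the generator\<close>

definition core :: "(ell1 \<times> ell1) set" where
  "core = {(to_ell1 w f, to_ell1 w (frag f)) | f N. f \<in> finseq N}"

lemma core_generator: "core \<subseteq> sg_generator T"
proof clarify
  fix x y assume "(x, y) \<in> core"
  then obtain f N where xy: "x = to_ell1 w f" "y = to_ell1 w (frag f)" and f: "f \<in> finseq N"
    by (auto simp: core_def)
  have "\<forall>\<^sub>F h in at_right 0. (T h x - x) /\<^sub>R h = to_ell1 w (\<lambda>n. (flow h f n - f n) / h)"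
    using eventually_at_right_less[of 0]
  proof eventually_elim
    case (elim h)
    then have "flow h f \<in> l1w w" "f \<in> l1w w"
      using finseq_l1w[OF flow_finseq[OF f]] finseq_l1w[OF f] by auto
    then show ?case
      by (simp add: xy T_to_ell1 to_ell1_diff[symmetric] to_ell1_scale[symmetric] l1w_diff[OF weight_pos]
          divide_inverse_commute)
  qed
  moreover have "((\<lambda>h. to_ell1 w (\<lambda>n. (flow h f n - f n) / h)) \<longlongrightarrow> y) (at_right 0)"
    unfolding xy
  proof (rule tendsto_to_ell1_finseq[OF _ frag_finseq[OF f]])
    show "\<forall>\<^sub>F h in at_right 0. (\<lambda>n. (flow h f n - f n) / h) \<in> finseq N"
      using eventually_at_right_less[of 0]
      by eventually_elim (use f flow_finseq[OF f] in \<open>auto simp: finseq_def\<close>)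
  qed (rule flow_component_limits(1)[OF f])
  ultimately show "(x, y) \<in> sg_generator T"
    by (simp add: sg_generator_def tendsto_cong)
qed

text \<open>Back substitution: on its last coordinate \<open>frag\<close> is multiplication by
  \<open>- a (Suc N)\<close>, so the top entry must be \<open>h (Suc N) / (1 + a (Suc N))\<close>.
  Removing its contribution leaves a right-hand side in \<open>finseq N\<close>.\<close>

lemma resolvent_finseq: "h \<in> finseq N \<Longrightarrow> \<exists>f\<in>finseq N. h = (\<lambda>n. f n - frag f n)"
proof (induction N arbitrary: h)
  case 0
  then have "h = (\<lambda>n. h n - frag h n)"
    using frag_finseq[OF 0] by (auto simp: finseq_def fun_eq_iff) (metis neq0_conv)
  with 0 show ?case by blast
next
  case (Suc N)
  define e where "e = (\<lambda>n. if n = Suc N then h n / (1 + a n) else 0)"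
  have e: "e \<in> finseq (Suc N)" by (simp add: e_def finseq_def)
  have "frag e (Suc N) = - a (Suc N) * e (Suc N)"
    by (simp add: frag_finseq_eq[OF e])
  moreover have "1 + a (Suc N) \<noteq> 0" using a_nonneg[of "Suc N"] by simp
  ultimately have top: "e (Suc N) - frag e (Suc N) = h (Suc N)"
    by (simp add: e_def field_simps)
  have "(\<lambda>n. h n - (e n - frag e n)) \<in> finseq N"
    unfolding finseq_def
  proof (intro CollectI conjI allI impI)
    show "h 0 - (e 0 - frag e 0) = 0" using Suc.prems e frag_finseq[OF e] by (simp add: finseq_def)
    show "h n - (e n - frag e n) = 0" if "n > N" for n
      using Suc.prems e frag_finseq[OF e] top that
      by (cases "n = Suc N") (auto simp: finseq_def)
  qed
  from Suc.IH[OF this] obtain g where g: "g \<in> finseq N"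
    and eq: "(\<lambda>n. h n - (e n - frag e n)) = (\<lambda>n. g n - frag g n)" by blast
  have g': "g \<in> finseq (Suc N)" using g finseq_mono[of N "Suc N"] by auto
  have "h = (\<lambda>n. (g n + e n) - frag (\<lambda>n. g n + e n) n)"
  proof
    show "h n = (g n + e n) - frag (\<lambda>n. g n + e n) n" for n
      using fun_cong[OF eq, of n] by (simp add: frag_add[OF g' e])
  qed
  moreover have "(\<lambda>n. g n + e n) \<in> finseq (Suc N)" using g' e by (simp add: finseq_def)
  ultimately show ?case by (rule bexI[of _ "\<lambda>n. g n + e n"])
qed

lemma core_range: "closure {x - y | x y. (x, y) \<in> core} = UNIV"
proof -
  have "to_ell1 w ` (\<Union>N. finseq N) \<subseteq> {x - y | x y. (x, y) \<in> core}"
  proof clarify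
    fix h N assume "h \<in> finseq N"
    then obtain f where f: "f \<in> finseq N" "h = (\<lambda>n. f n - frag f n)" using resolvent_finseq by blast
    have "to_ell1 w h = to_ell1 w f - to_ell1 w (frag f)"
      unfolding f(2)
      by (rule to_ell1_diff[OF finseq_l1w[OF f(1)] finseq_l1w[OF frag_finseq[OF f(1)]]])
    with f(1) show "\<exists>x y. to_ell1 w h = x - y \<and> (x, y) \<in> core"
      unfolding core_def by blast
  qed
  from closure_mono[OF this] finseq_dense show ?thesis by auto
qed

lemma generator_T: "sg_generator T = closure core"
  using T.generator_eq_closure[OF core_generator core_range] .

section \<open>Identification of the generator with \<open>G_op\<close>\<close>

text \<open>In row \<open>n\<close> the entries with index at most \<open>n\<close> are 0; dropping
  these \<open>n + 1\<close> terms produces the shifted index of \<open>B_seq\<close>.\<close>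

lemma mat_gain_eq_B_seq:
  assumes f: "(\<lambda>n. a n * f n) \<in> l1w w"
  shows "n \<ge> 1 \<Longrightarrow> summable (\<lambda>k. a (n + 1 + k) * b n (n + 1 + k) * f (n + 1 + k))"
    and "mat gain (\<lambda>n. a n * f n) = B_seq a b f"
proof -
  have s: "summable (\<lambda>j. gain n j * (a j * f j))" if "n \<ge> 1" for n
    using substoch_mat_summable[OF substoch_gain f that] .
  have eq: "gain n (k + (n + 1)) * (a (k + (n + 1)) * f (k + (n + 1)))
      = a (n + 1 + k) * b n (n + 1 + k) * f (n + 1 + k)" for n k
    by (simp add: gain_def algebra_simps)
  show "summable (\<lambda>k. a (n + 1 + k) * b n (n + 1 + k) * f (n + 1 + k))" if "n \<ge> 1" for n
    using summable_ignore_initial_segment[OF s[OF that], of "n + 1"] unfolding eq .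
  show "mat gain (\<lambda>n. a n * f n) = B_seq a b f"
  proof
    fix n
    show "mat gain (\<lambda>n. a n * f n) n = B_seq a b f n"
    proof (cases "n = 0")
      case False
      then have "(\<Sum>j. gain n j * (a j * f j)) = (\<Sum>k. a (n + 1 + k) * b n (n + 1 + k) * f (n + 1 + k))"
        using suminf_split_initial_segment[OF s, of n "n + 1"] unfolding eq
        by (simp add: gain_def)
      then show ?thesis using False by (simp add: mat_def B_seq_def)
    qed (simp add: mat_def B_seq_def)
  qed
qed

text \<open>If \<open>a f\<close> lies in \<open>l1w w\<close>, so does its image under
  \<open>gain\<close>; thus the domain of \<open>A_op\<close> lies in that of \<open>B_op\<close>
  and alone determines the domain of the sum.\<close>

lemma A_plus_B:
  "op_sum (A_op w a) (B_op w a b) = {(f, frag f) | f. f \<in> l1w w \<and> (\<lambda>n. a n * f n) \<in> l1w w}"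
proof -
  have "(f, k) \<in> op_sum (A_op w a) (B_op w a b) \<longleftrightarrow>
      f \<in> l1w w \<and> (\<lambda>n. a n * f n) \<in> l1w w \<and> k = frag f" for f k
  proof (cases "f \<in> l1w w \<and> (\<lambda>n. a n * f n) \<in> l1w w")
    case True
    then have "B_seq a b f \<in> l1w w" "frag f = (\<lambda>n. - a n * f n + B_seq a b f n)"
      using substoch_mat_bounded(1)[OF substoch_gain, of "\<lambda>n. a n * f n"]
      by (auto simp: frag_def fun_eq_iff simp flip: mat_gain_eq_B_seq(2))
    then show ?thesis
      using True mat_gain_eq_B_seq(1)[of f] by (auto simp: op_sum_def A_op_def B_op_def)
  qed (auto simp: op_sum_def A_op_def)
  then show ?thesis by auto
qed

text \<open>Truncation converges in the graph norm since \<open>B\<close> is bounded relative to \<open>A\<close>.\<close>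

lemma domain_A_in_closure_core:
  assumes f: "f \<in> l1w w" and af: "(\<lambda>n. a n * f n) \<in> l1w w"
  shows "frag f \<in> l1w w" "(to_ell1 w f, to_ell1 w (frag f)) \<in> closure core"
proof -
  define K where "K x = to_ell1 w (mat gain (of_ell1 w x))" for x
  have K: "bounded_linear K"
    unfolding K_def by (rule bounded_linear_substoch_mat[OF substoch_gain])
  have frag: "frag g \<in> l1w w" "to_ell1 w (frag g) = K (to_ell1 w (\<lambda>n. a n * g n)) - to_ell1 w (\<lambda>n. a n * g n)"
    if "(\<lambda>n. a n * g n) \<in> l1w w" for g
    using that substoch_mat_bounded(1)[OF substoch_gain that]
    by (simp_all add: frag_def[abs_def] l1w_diff[OF weight_pos] to_ell1_diff K_def)
  have f0: "f 0 = 0" using f by (simp add: l1w_def)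
  have tr: "trunc N f \<in> finseq N" for N by (rule trunc_finseq[where f = f, OF f0])
  have "(\<lambda>n. a n * trunc N f n) = trunc N (\<lambda>n. a n * f n)" for N
    by (auto simp: trunc_def)
  then have fragN: "to_ell1 w (frag (trunc N f))
      = K (to_ell1 w (trunc N (\<lambda>n. a n * f n))) - to_ell1 w (trunc N (\<lambda>n. a n * f n))" for N
    using frag(2)[OF finseq_l1w[OF a_finseq[OF tr]]] by simp
  show "frag f \<in> l1w w" using frag(1)[OF af] .
  have "(\<lambda>N. to_ell1 w (frag (trunc N f))) \<longlonglongrightarrow> to_ell1 w (frag f)"
    unfolding fragN frag(2)[OF af]
    by (intro tendsto_diff bounded_linear.tendsto[OF K] trunc_tendsto af)
  with trunc_tendsto[OF f]
  have "(\<lambda>N. (to_ell1 w (trunc N f), to_ell1 w (frag (trunc N f)))) \<longlonglongrightarrow> (to_ell1 w f, to_ell1 w (frag f))"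
    by (rule tendsto_Pair)
  moreover have "(to_ell1 w (trunc N f), to_ell1 w (frag (trunc N f))) \<in> core" for N
    using tr unfolding core_def by blast
  ultimately show "(to_ell1 w f, to_ell1 w (frag f)) \<in> closure core"
    unfolding closure_sequential
    by (intro exI[of _ "\<lambda>N. (to_ell1 w (trunc N f), to_ell1 w (frag (trunc N f)))"]) simp
qed

text \<open>\<open>P\<close> is the graph of the sum, pulled back to \<open>ell1\<close>. It lies
  between \<open>core\<close> and \<open>closure core\<close>, so all three have the same
  closure.\<close>

lemma G_op_eq: "G_op w a b = map_prod (of_ell1 w) (of_ell1 w) ` sg_generator T"
proof -
  define P where "P = {(to_ell1 w f, to_ell1 w (frag f)) | f. f \<in> l1w w \<and> (\<lambda>n. a n * f n) \<in> l1w w}"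
  have "op_sum (A_op w a) (B_op w a b) = map_prod (of_ell1 w) (of_ell1 w) ` P"
  proof -
    have "map_prod (of_ell1 w) (of_ell1 w) (to_ell1 w f, to_ell1 w (frag f)) = (f, frag f)"
      if "f \<in> l1w w" "(\<lambda>n. a n * f n) \<in> l1w w" for f
      using that domain_A_in_closure_core(1) by simp
    then show ?thesis unfolding A_plus_B P_def by (force simp: image_iff)
  qed
  then have "G_op w a b = map_prod (of_ell1 w) (of_ell1 w) ` closure P"
    by (simp only: G_op_def op_closure_eq)
  moreover have "closure P = closure core"
  proof
    have "core \<subseteq> P"
      unfolding core_def P_def using finseq_l1w a_finseq by blast
    then show "closure core \<subseteq> closure P" by (rule closure_mono)
    have "P \<subseteq> closure core" unfolding P_def using domain_A_in_closure_core by blast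
    then show "closure P \<subseteq> closure core" by (rule closure_minimal) simp
  qed
  ultimately show ?thesis by (simp add: generator_T)
qed

lemma Domain_generator_T_dense: "closure (Domain (sg_generator T)) = UNIV"
proof -
  have "to_ell1 w ` (\<Union>N. finseq N) \<subseteq> Domain (sg_generator T)"
    using core_generator by (force simp: core_def)
  from closure_mono[OF this] show ?thesis using finseq_dense by auto
qed

section \<open>The generated semigroup and the Cauchy problem\<close>

lemma generated_semigroup_G:
  defines "S \<equiv> generated_semigroup w (G_op w a b)"
  shows "C0_semigroup w S" "generator w S = G_op w a b"
proof -
  define R where "R t f = of_ell1 w (T t (to_ell1 w f))" for t f
  have R: "C0_semigroup w R"
    unfolding R_def[abs_def] by (rule C0_semigroup_of_C0_sg) (rule T.C0_sg_axioms)
  moreover have "ell1_family R = T"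
    by (simp add: fun_eq_iff R_def ell1_family_def)
  ultimately have "C0_semigroup w R \<and> generator w R = G_op w a b"
    by (simp add: generator_eq G_op_eq)
  then have "C0_semigroup w S \<and> generator w S = G_op w a b"
    unfolding S_def generated_semigroup_def
    by (rule someI[of "\<lambda>S. C0_semigroup w S \<and> generator w S = G_op w a b"])
  then show "C0_semigroup w S" "generator w S = G_op w a b" by auto
qed

lemma generated_semigroup_eq_T:
  assumes "t \<ge> 0"
  shows "generated_semigroup w (G_op w a b) t (of_ell1 w x) = of_ell1 w (T t x)"
proof -
  let ?S = "generated_semigroup w (G_op w a b)"
  note S = generated_semigroup_G
  have "inj (map_prod (of_ell1 w) (of_ell1 w))"
    by (intro prod.inj_map injI) (simp_all add: inj_of_ell1)
  moreover have "map_prod (of_ell1 w) (of_ell1 w) ` sg_generator (ell1_family ?S)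
      = map_prod (of_ell1 w) (of_ell1 w) ` sg_generator T"
    using generator_eq[OF S(1)] S(2) G_op_eq by simp
  ultimately have "sg_generator (ell1_family ?S) = sg_generator T"
    by (simp add: inj_image_eq_iff)
  from T.same_generator_unique[OF C0_sg_ell1_family[OF S(1)] this Domain_generator_T_dense assms]
  have "ell1_family ?S t x = T t x" .
  then show ?thesis using of_ell1_family[OF S(1) assms, of x] by simp
qed

lemma flow_eq:
  assumes "t \<ge> 0" "f \<in> l1w w"
  shows "generated_semigroup w (G_op w a b) t f = flow t f"
  using generated_semigroup_eq_T[OF assms(1), of "to_ell1 w f"] assms
    substoch_mat_bounded(1)[OF substoch_col[OF assms(1)] assms(2)]
  by (simp add: T_to_ell1 flow_def)

lemma flow_nonneg:
  assumes f: "f \<in> l1w w" "nonneg f" and t: "t \<ge> 0"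
  shows "nonneg (flow t f)"
  unfolding nonneg_def
proof
  fix n
  show "0 \<le> flow t f n"
  proof (cases "n = 0")
    case False
    then have "0 \<le> (\<Sum>j. col j n t * f j)"
      using f t by (intro suminf_nonneg substoch_mat_summable[OF substoch_col[OF t] f(1)])
        (auto simp: nonneg_def col_nonneg)
    then show ?thesis using False by (simp add: flow_def mat_def)
  qed (simp add: flow_def mat_def)
qed

lemma substochastic_generated: "substochastic w (generated_semigroup w (G_op w a b))"
  unfolding substochastic_def
  using flow_nonneg substoch_mat_bounded(2)[OF substoch_col] by (simp add: flow_eq flow_def)

lemma classical_solution_flow:
  assumes "f \<in> Domain (G_op w a b)"
  shows "classical_solution w (G_op w a b) f (\<lambda>t. generated_semigroup w (G_op w a b) t f)"
proof -
  from assms obtain x g where f: "f = of_ell1 w x" and xg: "(x, g) \<in> sg_generator T"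
    by (auto simp: G_op_eq)
  show ?thesis
    unfolding G_op_eq
  proof (subst classical_solution_iff[of _ "\<lambda>t. T t x"])
    show "generated_semigroup w (map_prod (of_ell1 w) (of_ell1 w) ` sg_generator T) t f = of_ell1 w (T t x)"
      if "t \<ge> 0" for t
      using generated_semigroup_eq_T[OF that, of x] by (simp add: f G_op_eq)
    \<comment> \<open>The derivative of the orbit of \<open>x\<close> is the orbit of
      \<open>g\<close>, which makes the solution continuously differentiable.\<close>
    have "continuous_on {0<..} (\<lambda>t. T t g)"
      using T.continuous_orbit by (rule continuous_on_subset) auto
    moreover have "((\<lambda>t. T t x) has_vector_derivative T t g) (at t) \<and> (T t x, T t g) \<in> sg_generator T"
      if "t > 0" for t
      using T.orbit_has_vector_derivative[OF xg that] T.generator_invariant(1)[OF xg, of t] that by simp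
    moreover have "generated_semigroup w (map_prod (of_ell1 w) (of_ell1 w) ` sg_generator T) 0 f = f"
      using generated_semigroup_eq_T[of 0 x] by (simp add: f G_op_eq T.zero)
    ultimately show "continuous_on {0..} (\<lambda>t. T t x) \<and>
        (\<exists>v'. continuous_on {0<..} v' \<and>
          (\<forall>t>0. ((\<lambda>t. T t x) has_vector_derivative v' t) (at t) \<and> (T t x, v' t) \<in> sg_generator T)) \<and>
        generated_semigroup w (map_prod (of_ell1 w) (of_ell1 w) ` sg_generator T) 0 f = f"
      using T.continuous_orbit by blast
  qed
qed

lemma classical_solution_unique:
  assumes f: "f \<in> Domain (G_op w a b)" and sol: "classical_solution w (G_op w a b) f u" and t: "t \<ge> 0"
  shows "u t = generated_semigroup w (G_op w a b) t f"
proof -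
  from f obtain x g where f: "f = of_ell1 w x" and xg: "(x, g) \<in> sg_generator T"
    by (auto simp: G_op_eq)
  \<comment> \<open>A continuous map takes values in the space of its target topology; this is what
    allows the pullback to \<open>ell1\<close>.\<close>
  have "u t \<in> l1w w" if "t \<ge> 0" for t
    using sol that by (auto simp: classical_solution_def continuous_map_def top_w_def)
  then have u: "u t = of_ell1 w (to_ell1 w (u t))" if "t \<ge> 0" for t
    using that by simp
  define v where "v t = to_ell1 w (u t)" for t
  have v: "u t = of_ell1 w (v t)" if "t \<ge> 0" for t using u[OF that] by (simp add: v_def)
  have "continuous_on {0..} v \<and>
      (\<exists>v'. continuous_on {0<..} v' \<and> (\<forall>t>0. (v has_vector_derivative v' t) (at t) \<and> (v t, v' t) \<in> sg_generator T)) \<and>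
      u 0 = f"
    using sol unfolding G_op_eq by (rule classical_solution_iff[THEN iffD1, rotated]) (rule v)
  then obtain v' where v': "continuous_on {0..} v" "u 0 = f"
    "\<And>t. t > 0 \<Longrightarrow> (v has_vector_derivative v' t) (at t)" "\<And>t. t > 0 \<Longrightarrow> (v t, v' t) \<in> sg_generator T"
    by blast
  have v0: "v 0 = x" using v'(2) by (simp add: v_def f)
  have "v t = T t (v 0)"
  proof (rule T.orbit_unique[OF v'(1) _ _ t])
    show "\<exists>g. (v t, g) \<in> sg_generator T \<and> ((\<lambda>h. (v (t + h) - v t) /\<^sub>R h) \<longlongrightarrow> g) (at_right 0)"
      if "t > 0" for t
      using v'(3,4)[OF that] unfolding has_vector_derivative_iff_quotient
      by (auto intro: filterlim_mono[OF _ order_refl at_le])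
    show "(v 0, g) \<in> sg_generator T" using xg v0 by simp
  qed
  then show ?thesis using v[OF t] generated_semigroup_eq_T[OF t, of x] by (simp add: v0 f)
qed

section \<open>Conservation of mass\<close>

lemma mass_finseq: "f \<in> finseq N \<Longrightarrow> mass f = (\<Sum>n=1..N. real n * f n)"
  by (simp add: mass_def finseq_suminf)

text \<open>In the balance with \<open>v = real\<close> every term is 0: for size 1 because
  \<open>a 1 = 0\<close>, for larger sizes because the fragments carry exactly the mass of the
  parent.\<close>

lemma mass_flow_finseq:
  assumes a1: "a 1 = 0" and bm: "\<And>j. j \<ge> 2 \<Longrightarrow> (\<Sum>n=1..j-1. real n * b n j) = real j"
    and f: "f \<in> finseq N" and t: "t \<ge> 0"
  shows "mass (flow t f) = mass f"
proof -
  have 0: "(\<Sum>k=1..N. a k * flow t f k * ((\<Sum>n=1..k-1. real n * b n k) - real k)) = 0" for t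
  proof (rule sum.neutral, rule ballI)
    fix k assume "k \<in> {1..N}"
    then show "a k * flow t f k * ((\<Sum>n=1..k-1. real n * b n k) - real k) = 0"
      using a1 bm[of k] by (cases "k = 1") auto
  qed
  have "\<exists>c. \<forall>t\<in>{0..}. (\<Sum>n=1..N. real n * flow t f n) = c"
  proof (rule has_field_derivative_zero_constant)
    show "((\<lambda>t. \<Sum>n=1..N. real n * flow t f n) has_real_derivative 0) (at t within {0..})" if "t \<in> {0..}" for t
      using weighted_sum_solution_derivative[OF flow_solves[OF f], of t real] that unfolding 0 by simp
  qed simp
  then obtain c where "\<And>t. t \<ge> 0 \<Longrightarrow> (\<Sum>n=1..N. real n * flow t f n) = c" by auto
  from this[of t] this[of 0] show ?thesis
    using t by (simp add: mass_finseq[OF f] mass_finseq[OF flow_finseq[OF f t]] flow_0[OF f])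
qed

text \<open>\<open>w n\<close> being at least \<open>n\<close> makes the mass a functional of norm
  at most 1, so conservation extends from finite sequences by density.\<close>

lemma bounded_linear_mass:
  assumes w: "\<And>n. n \<ge> 1 \<Longrightarrow> real n \<le> w n"
  shows "bounded_linear (\<lambda>x. mass (of_ell1 w x))"
proof -
  have le: "\<bar>real n * of_ell1 w x n\<bar> \<le> \<bar>Rep_ell1 x n\<bar>" for x n
  proof (cases "n = 0")
    case False
    then have "real n * \<bar>of_ell1 w x n\<bar> \<le> w n * \<bar>of_ell1 w x n\<bar>"
      using w by (intro mult_right_mono) auto
    then show ?thesis by (simp add: w_times_abs_of_ell1 abs_mult)
  qed simp
  have s: "summable (\<lambda>n. \<bar>real n * of_ell1 w x n\<bar>)" for x
    by (rule summable_comparison_test'[OF summable_Rep_ell1[of x]]) (simp add: le)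
  note s' = summable_rabs_cancel[OF s]
  show ?thesis
  proof (rule bounded_linear_intro[of _ 1])
    show "mass (of_ell1 w (x + y)) = mass (of_ell1 w x) + mass (of_ell1 w y)" for x y
      using suminf_add[OF s' s', of x y] by (simp add: mass_def of_ell1_add distrib_left)
    show "mass (of_ell1 w (c *\<^sub>R x)) = c *\<^sub>R mass (of_ell1 w x)" for c x
      using suminf_mult[OF s', of c x] by (simp add: mass_def of_ell1_scaleR algebra_simps)
    show "norm (mass (of_ell1 w x)) \<le> norm x * 1" for x
    proof -
      have "\<bar>mass (of_ell1 w x)\<bar> \<le> (\<Sum>n. \<bar>real n * of_ell1 w x n\<bar>)"
        unfolding mass_def by (rule summable_rabs[OF s])
      also have "\<dots> \<le> (\<Sum>n. \<bar>Rep_ell1 x n\<bar>)"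
        by (rule suminf_le[OF le s summable_Rep_ell1])
      finally show ?thesis by (simp add: norm_ell1.rep_eq norm_w_def)
    qed
  qed
qed

lemma mass_flow:
  assumes w: "\<And>n. n \<ge> 1 \<Longrightarrow> real n \<le> w n"
    and a1: "a 1 = 0" and bm: "\<And>j. j \<ge> 2 \<Longrightarrow> (\<Sum>n=1..j-1. real n * b n j) = real j"
    and f: "f \<in> l1w w" and t: "t \<ge> 0"
  shows "mass (flow t f) = mass f"
proof -
  have "mass (of_ell1 w (T t x)) = mass (of_ell1 w x)" for x
  proof (rule bounded_linear_eq_on_dense[OF _ bounded_linear_mass finseq_dense])
    show "bounded_linear (\<lambda>x. mass (of_ell1 w (T t x)))"
      using bounded_linear_compose[OF bounded_linear_mass T.bl[OF t]] w by blast
    fix x assume "x \<in> to_ell1 w ` (\<Union>N. finseq N)"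
    then obtain g N where x: "x = to_ell1 w g" and g: "g \<in> finseq N" by auto
    show "mass (of_ell1 w (T t x)) = mass (of_ell1 w x)"
      using mass_flow_finseq[OF a1 bm g t] finseq_l1w[OF g] finseq_l1w[OF flow_finseq[OF g t]]
      by (simp add: x T_to_ell1)
  qed (rule w)
  from this[of "to_ell1 w f"] show ?thesis
    using f substoch_mat_bounded(1)[OF substoch_col[OF t] f] by (simp add: T_to_ell1 flow_def)
qed

end

theorem corollary3p6:
  fixes a w u0 :: "nat \<Rightarrow> real" and b :: "nat \<Rightarrow> nat \<Rightarrow> real"
  assumes "\<forall>n\<ge>1. 0 \<le> a n"
    and "\<forall>n\<ge>1. \<forall>j\<ge>1. 0 \<le> b n j"
    and "\<forall>n\<ge>1. \<forall>j\<ge>1. j \<le> n \<longrightarrow> b n j = 0"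
    and "\<forall>n\<ge>1. 0 < w n"
    and "\<forall>n\<ge>1. real n \<le> w n"
    and "\<exists>\<kappa>. 0 < \<kappa> \<and> \<kappa> \<le> 1 \<and> (\<forall>j\<ge>2. (\<Sum>n=1..j-1. w n * b n j) \<le> \<kappa> * w j)"
    and "u0 \<in> Domain (G_op w a b)"
  shows "let G = G_op w a b; S = generated_semigroup w G in
      (C0_semigroup w S \<and> substochastic w S \<and> generator w S = G) \<and>
      classical_solution w G u0 (\<lambda>t. S t u0) \<and>
      (\<forall>u. classical_solution w G u0 u \<longrightarrow> (\<forall>t\<ge>0. u t = S t u0)) \<and>
      (nonneg u0 \<longrightarrow> (\<forall>t\<ge>0. nonneg (S t u0))) \<and>
      (a 1 = 0 \<and> (\<forall>j\<ge>2. (\<Sum>n=1..j-1. real n * b n j) = real j) \<and> nonneg u0 \<longrightarrow>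
        (\<forall>t\<ge>0. mass (S t u0) = mass u0))"
proof -
  obtain \<kappa> where \<kappa>: "\<kappa> \<le> 1" "\<And>j. j \<ge> 2 \<Longrightarrow> (\<Sum>n=1..j-1. w n * b n j) \<le> \<kappa> * w j"
    using assms(6) by blast
  interpret fragmentation w a b
  proof
    \<comment> \<open>Only \<kappa> \<le> 1 is used: the fragments of a particle never outweigh
      it.\<close>
    fix j :: nat assume j: "j \<ge> 2"
    then have "w j > 0" using assms(4) by simp
    then have "\<kappa> * w j \<le> w j" using \<kappa>(1) by simp
    with \<kappa>(2)[OF j] show "(\<Sum>n=1..j-1. w n * b n j) \<le> w j" by simp
  qed (use assms in auto)
  have u0: "u0 \<in> l1w w" using assms(7) by (auto simp: G_op_eq)
  let ?S = "generated_semigroup w (G_op w a b)"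
  have "nonneg (?S t u0)" if "nonneg u0" "t \<ge> 0" for t
    using flow_nonneg[OF u0 that] by (simp add: flow_eq u0 that)
  moreover have "mass (?S t u0) = mass u0"
    if "a 1 = 0" "\<forall>j\<ge>2. (\<Sum>n=1..j-1. real n * b n j) = real j" "t \<ge> 0" for t
    using mass_flow[OF _ that(1) _ u0 that(3)] that assms(5) by (simp add: flow_eq u0)
  ultimately show ?thesis
    unfolding Let_def
    using generated_semigroup_G substochastic_generated classical_solution_flow[OF assms(7)]
      classical_solution_unique[OF assms(7)]
    by (intro conjI allI impI) blast+
qed

end
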